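(* Let $A, B\in\mathcal{B}(\mathcal{H})$ be positive invertible operators on a complex Hilbert space $\mathcal{H}$, let $\Phi$ be a positive linear map on $\mathcal{B}(\mathcal{H})$, let $t\in[0,1]$, and put $r=\min\{t,1-t\}$, $R=\max\{t,1-t\}$, $r_{0}=\min\{2r,1-2r\}$. (i) If $0<t\leq\frac12$, then $$\begin{aligned}\Phi(A)\sharp_{t}\Phi(B)-\Phi(A\sharp_{t}B)\le{}&2R\Big(\Phi(A)\sharp\Phi(B)-\Phi(A\sharp B)+\tfrac12\big(\Phi(A)+\Phi(B)-2\,\Phi(A)\sharp\Phi(B)\big)\Big)\\&-r_{0}\Big(\Phi(A\sharp B)+\Phi(B)-2\Phi(A\sharp_{\frac34}B)\Big)\\&-r_{0}\Big(\Phi(A)\sharp\Phi(B)+\Phi(A)-2\big(\Phi(A)\sharp_{\frac14}\Phi(B)\big)\Big)\\\le{}&2R\Big(\Phi(A)\sharp\Phi(B)-\Phi(A\sharp B)+\tfrac12\big(\Phi(A)+\Phi(B)-2\,\Phi(A)\sharp\Phi(B)\big)\Big).\end{aligned}$$ (ii) If $\frac12<t<1$, then $$\begin{aligned}\Phi(A)\sharp_{t}\Phi(B)-\Phi(A\sharp_{t}B)\le{}&2R\Big(\Phi(A)\sharp\Phi(B)-\Phi(A\sharp B)+\tfrac12\big(\Phi(A)+\Phi(B)-2\,\Phi(A)\sharp\Phi(B)\big)\Big)\\&-r_{0}\Big(\Phi(A)\sharp\Phi(B)+\Phi(B)-2\big(\Phi(A)\sharp_{\frac34}\Phi(B)\big)\Big)\\&-r_{0}\Big(\Phi(A\sharp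 B)+\Phi(A)-2\Phi(A\sharp_{\frac14}B)\Big)\\\le{}&2R\Big(\Phi(A)\sharp\Phi(B)-\Phi(A\sharp B)+\tfrac12\big(\Phi(A)+\Phi(B)-2\,\Phi(A)\sharp\Phi(B)\big)\Big).\end{aligned}$$
   Context: $\mathcal{B}(\mathcal{H})$ is the $C^*$-algebra of bounded linear operators on $\mathcal{H}$; $X\le Y$ means $Y-X$ is positive. A linear map $\Phi$ is positive if $\Phi(X)\ge0$ whenever $X\ge 0$. For positive invertible $A,B$ and $u\in[0,1]$, $A\sharp_{u}B=A^{1/2}(A^{-1/2}BA^{-1/2})^{u}A^{1/2}$, and $A\sharp B=A\sharp_{1/2}B$. If the positive operators are not invertible (which may occur for $\Phi(A),\Phi(B)$), $A\sharp_uB$ is the strong-operator limit of $(A+\varepsilon I)\sharp_u(B+\varepsilon I)$ as $\varepsilon\downarrow0$. *)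

theory Defs
  imports "HOL-Analysis.Analysis"
begin

class scaleC = scaleR +
  fixes scaleC :: "complex \<Rightarrow> 'a \<Rightarrow> 'a"  (infixr \<open>*\<^sub>C\<close> 75)
  assumes scaleR_scaleC: "r *\<^sub>R x = complex_of_real r *\<^sub>C x"

class complex_vector = scaleC + ab_group_add +
  assumes scaleC_add_right: "a *\<^sub>C (x + y) = a *\<^sub>C x + a *\<^sub>C y"
    and scaleC_add_left: "(a + b) *\<^sub>C x = a *\<^sub>C x + b *\<^sub>C x"
    and scaleC_scaleC: "a *\<^sub>C b *\<^sub>C x = (a * b) *\<^sub>C x"
    and scaleC_one: "1 *\<^sub>C x = x"

abbreviation clinear :: "('a::complex_vector \<Rightarrow> 'b::complex_vector) \<Rightarrow> bool"
  where "clinear \<equiv> Vector_Spaces.linear (*\<^sub>C) (*\<^sub>C)"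

text \<open>The inner product is linear in its first argument. Completeness is part of \<^class>\<open>banach\<close>;
  positive definiteness follows from \<open>cinner_self\<close>.\<close>

class complex_hilbert = complex_vector + banach +
  fixes cinner :: "'a \<Rightarrow> 'a \<Rightarrow> complex"
  assumes cinner_commute: "cinner x y = cnj (cinner y x)"
    and cinner_add_left: "cinner (x + y) z = cinner x z + cinner y z"
    and cinner_scaleC_left: "cinner (c *\<^sub>C x) y = c * cinner x y"
    and cinner_self: "cinner x x = complex_of_real ((norm x)\<^sup>2)"

lemma scaleC_zero_right: "c *\<^sub>C 0 = (0 :: 'a::complex_vector)"
  using scaleC_add_right[of c 0 0] by simp

lemma vector_space_scaleC: "vector_space ((*\<^sub>C) :: complex \<Rightarrow> 'a \<Rightarrow> 'a::complex_vector)"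
  by unfold_locales
    (simp_all add: scaleC_add_right scaleC_add_left scaleC_scaleC scaleC_one)

lemma clinear_iff:
  "clinear f \<longleftrightarrow> (\<forall>x y. f (x + y) = f x + f y) \<and> (\<forall>c x. f (c *\<^sub>C x) = c *\<^sub>C f x)"
  by (simp add: Vector_Spaces.linear_iff vector_space_scaleC)

lemma cinner_add_right: "cinner x (y + z) = cinner x y + cinner x (z :: 'a::complex_hilbert)"
  by (metis cinner_commute cinner_add_left complex_cnj_add)

lemma cinner_scaleC_right: "cinner x (c *\<^sub>C y) = cnj c * cinner x (y :: 'a::complex_hilbert)"
  by (metis cinner_commute cinner_scaleC_left complex_cnj_mult)

lemma cinner_zero_left: "cinner 0 (x :: 'a::complex_hilbert) = 0"
  using cinner_add_left[of 0 0 x] by simp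

lemma cinner_minus_left: "cinner (- x) (y :: 'a::complex_hilbert) = - cinner x y"
  using cinner_add_left[of x "- x" y] cinner_zero_left[of y]
  by (simp add: minus_unique)

lemma cinner_diff_left: "cinner (x - y) (z :: 'a::complex_hilbert) = cinner x z - cinner y z"
  using cinner_add_left[of x "- y" z] by (simp add: cinner_minus_left)

lemma norm_scaleC: "norm (c *\<^sub>C x) = cmod c * norm (x :: 'a::complex_hilbert)"
proof -
  have "complex_of_real ((norm (c *\<^sub>C x))\<^sup>2) = c * cnj c * cinner x x"
    by (simp only: cinner_self[symmetric] cinner_scaleC_left cinner_scaleC_right mult.assoc
        mult.left_commute)
  also have "\<dots> = complex_of_real ((cmod c * norm x)\<^sup>2)"
    by (simp only: complex_norm_square cinner_self power_mult_distrib of_real_mult)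
  finally have "(norm (c *\<^sub>C x))\<^sup>2 = (cmod c * norm x)\<^sup>2"
    unfolding of_real_eq_iff .
  then show ?thesis by simp
qed

lemma bounded_linear_scaleC: "bounded_linear (\<lambda>x :: 'a::complex_hilbert. c *\<^sub>C x)"
  by (rule bounded_linear_intro[where K = "cmod c"])
    (simp_all add: scaleC_add_right scaleR_scaleC scaleC_scaleC norm_scaleC mult.commute)

typedef (overloaded) 'a bounded_op =
  "{T :: 'a::complex_hilbert \<Rightarrow> 'a. clinear T \<and> bounded_linear T}"
  morphisms op_apply Bounded_op
  by (rule exI[of _ "\<lambda>x. x"]) (simp add: clinear_iff)

setup_lifting type_definition_bounded_op

lemma bounded_op_eqI: "(\<And>x. op_apply X x = op_apply Y x) \<Longrightarrow> X = Y"
  by (simp add: op_apply_inject[symmetric] fun_eq_iff)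

lemma bounded_linear_op_apply: "bounded_linear (op_apply X)"
  using op_apply[of X] by simp

lemma op_apply_add: "op_apply X (x + y) = op_apply X x + op_apply X y"
  using op_apply[of X] by (simp add: clinear_iff)

lemma op_apply_scaleC: "op_apply X (c *\<^sub>C x) = c *\<^sub>C op_apply X x"
  using op_apply[of X] by (simp add: clinear_iff)

instantiation bounded_op :: (complex_hilbert) real_vector
begin

lift_definition zero_bounded_op :: "'a bounded_op" is "\<lambda>x. 0"
  by (simp add: clinear_iff scaleC_zero_right)

lift_definition plus_bounded_op :: "'a bounded_op \<Rightarrow> 'a bounded_op \<Rightarrow> 'a bounded_op"
  is "\<lambda>S T x. S x + T x"
  by (auto simp: clinear_iff scaleC_add_right algebra_simps intro: bounded_linear_add)

lift_definition uminus_bounded_op :: "'a bounded_op \<Rightarrow> 'a bounded_op" is "\<lambda>T x. - T x"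
proof -
  fix T :: "'a \<Rightarrow> 'a" assume "clinear T \<and> bounded_linear T"
  moreover have "- (c *\<^sub>C x) = c *\<^sub>C (- x)" for c and x :: 'a
  proof (rule minus_unique)
    show "c *\<^sub>C x + c *\<^sub>C (- x) = 0"
      by (simp flip: scaleC_add_right add: scaleC_zero_right)
  qed
  ultimately show "clinear (\<lambda>x. - T x) \<and> bounded_linear (\<lambda>x. - T x)"
    by (auto simp: clinear_iff intro: bounded_linear_minus)
qed

definition minus_bounded_op :: "'a bounded_op \<Rightarrow> 'a bounded_op \<Rightarrow> 'a bounded_op"
  where "minus_bounded_op X Y = X + - Y"

lift_definition scaleR_bounded_op :: "real \<Rightarrow> 'a bounded_op \<Rightarrow> 'a bounded_op"
  is "\<lambda>r T x. r *\<^sub>R T x"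
  by (auto simp: clinear_iff scaleR_scaleC scaleC_add_right scaleC_scaleC mult.commute
      intro!: bounded_linear_compose[OF bounded_linear_scaleC])

instance
  by standard (transfer; simp add: fun_eq_iff algebra_simps minus_bounded_op_def;
    transfer; simp add: fun_eq_iff algebra_simps)+

end

instantiation bounded_op :: (complex_hilbert) complex_vector
begin

lift_definition scaleC_bounded_op :: "complex \<Rightarrow> 'a bounded_op \<Rightarrow> 'a bounded_op"
  is "\<lambda>c T x. c *\<^sub>C T x"
  by (auto simp: clinear_iff scaleC_add_right scaleC_scaleC mult.commute
      intro!: bounded_linear_compose[OF bounded_linear_scaleC])

instance
  by standard (transfer; simp add: fun_eq_iff scaleR_scaleC scaleC_add_right scaleC_add_left
      scaleC_scaleC scaleC_one)+

end

instantiation bounded_op :: (complex_hilbert) real_normed_vector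
begin

lift_definition norm_bounded_op :: "'a bounded_op \<Rightarrow> real" is onorm .

definition dist_bounded_op :: "'a bounded_op \<Rightarrow> 'a bounded_op \<Rightarrow> real"
  where "dist_bounded_op X Y = norm (X - Y)"

definition sgn_bounded_op :: "'a bounded_op \<Rightarrow> 'a bounded_op"
  where "sgn_bounded_op X = inverse (norm X) *\<^sub>R X"

definition uniformity_bounded_op :: "('a bounded_op \<times> 'a bounded_op) filter"
  where [code del]: "uniformity_bounded_op = (INF e\<in>{0<..}. principal {(X, Y). dist X Y < e})"

definition open_bounded_op :: "'a bounded_op set \<Rightarrow> bool"
  where [code del]: "open_bounded_op S \<longleftrightarrow>
    (\<forall>X\<in>S. \<forall>\<^sub>F (X', Y) in uniformity. X' = X \<longrightarrow> Y \<in> S)"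

instance
proof
  fix X Y :: "'a bounded_op" and r :: real
  show "(norm X = 0) = (X = 0)" by transfer (simp add: onorm_eq_0 fun_eq_iff)
  show "norm (X + Y) \<le> norm X + norm Y" by transfer (simp add: onorm_triangle)
  show "norm (r *\<^sub>R X) = \<bar>r\<bar> * norm X" by transfer (simp add: onorm_scaleR)
qed (simp_all only: dist_bounded_op_def sgn_bounded_op_def uniformity_bounded_op_def
    open_bounded_op_def)

end

instantiation bounded_op :: (complex_hilbert) "{real_normed_algebra, monoid_mult}"
begin

lift_definition one_bounded_op :: "'a bounded_op" is "\<lambda>x. x"
  by (simp add: clinear_iff)

lift_definition times_bounded_op :: "'a bounded_op \<Rightarrow> 'a bounded_op \<Rightarrow> 'a bounded_op"
  is "\<lambda>S T x. S (T x)"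
  by (auto simp: clinear_iff intro: bounded_linear_compose)

instance
proof
  fix X Y Z :: "'a bounded_op" and r :: real
  show "X * Y * Z = X * (Y * Z)" by transfer simp
  show "1 * X = X" by transfer simp
  show "X * 1 = X" by transfer simp
  show "(X + Y) * Z = X * Z + Y * Z" by transfer simp
  show "X * (Y + Z) = X * Y + X * Z" by transfer (simp add: clinear_iff)
  show "r *\<^sub>R X * Y = r *\<^sub>R (X * Y)" by transfer simp
  show "X * r *\<^sub>R Y = r *\<^sub>R (X * Y)" by transfer (simp add: clinear_iff scaleR_scaleC)
  show "norm (X * Y) \<le> norm X * norm Y"
    by transfer (use onorm_compose in \<open>auto simp: o_def\<close>)
qed

end

lemma op_apply_diff: "op_apply (X - Y) x = op_apply X x - op_apply Y x"
  unfolding minus_bounded_op_def plus_bounded_op.rep_eq uminus_bounded_op.rep_eq by simp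

lemmas op_apply_simps = zero_bounded_op.rep_eq one_bounded_op.rep_eq plus_bounded_op.rep_eq
  uminus_bounded_op.rep_eq op_apply_diff scaleR_bounded_op.rep_eq scaleC_bounded_op.rep_eq
  times_bounded_op.rep_eq

text \<open>On a complex Hilbert space a real-valued quadratic form forces self-adjointness, so the
  latter need not be required separately.\<close>

definition op_positive :: "'a::complex_hilbert bounded_op \<Rightarrow> bool"
  where "op_positive X \<longleftrightarrow> (\<forall>x. cinner (op_apply X x) x \<in> \<real>\<^sub>\<ge>\<^sub>0)"

lemma op_positive_iff:
  "op_positive X \<longleftrightarrow>
    (\<forall>x. 0 \<le> Re (cinner (op_apply X x) x) \<and> Im (cinner (op_apply X x) x) = 0)"
  by (simp add: op_positive_def complex_nonneg_Reals_iff)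

lemma bounded_op_eq_0I:
  assumes "\<And>x. cinner (op_apply X x) x = 0"
  shows "X = 0"
proof (rule bounded_op_eqI)
  fix x
  let ?y = "op_apply X x"
  have "cinner (op_apply X x) ?y + cinner (op_apply X ?y) x = 0"
    using assms[of "x + ?y"] by (simp add: op_apply_add cinner_add_left cinner_add_right assms add.commute)
  moreover have "- \<i> * cinner (op_apply X x) ?y + \<i> * cinner (op_apply X ?y) x = 0"
    using assms[of "x + \<i> *\<^sub>C ?y"] assms[of "\<i> *\<^sub>C ?y"] assms[of x]
    by (simp add: op_apply_add op_apply_scaleC cinner_add_left cinner_add_right
        cinner_scaleC_left cinner_scaleC_right)
  then have "\<i> * (cinner (op_apply X ?y) x - cinner (op_apply X x) ?y) = 0"
    by (simp add: algebra_simps)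
  ultimately have "cinner ?y ?y = 0" by simp
  then show "op_apply X x = op_apply 0 x" by (simp add: cinner_self op_apply_simps)
qed

instantiation bounded_op :: (complex_hilbert) ordered_ab_group_add
begin

definition less_eq_bounded_op :: "'a bounded_op \<Rightarrow> 'a bounded_op \<Rightarrow> bool"
  where "less_eq_bounded_op X Y \<longleftrightarrow> op_positive (Y - X)"

definition less_bounded_op :: "'a bounded_op \<Rightarrow> 'a bounded_op \<Rightarrow> bool"
  where "less_bounded_op X Y \<longleftrightarrow> X \<le> Y \<and> \<not> Y \<le> X"

instance
proof
  fix X Y Z :: "'a bounded_op"
  show "X < Y \<longleftrightarrow> X \<le> Y \<and> \<not> Y \<le> X" by (rule less_bounded_op_def)
  show "X \<le> X"
    by (simp add: less_eq_bounded_op_def op_positive_iff op_apply_simps cinner_zero_left)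
  show "X \<le> Z" if "X \<le> Y" "Y \<le> Z"
    using that
    by (auto simp: less_eq_bounded_op_def op_positive_iff op_apply_simps cinner_diff_left)
      (meson order_trans)
  show "X = Y" if "X \<le> Y" "Y \<le> X"
  proof -
    have "cinner (op_apply (X - Y) x) x = 0" for x
      using that
      by (auto simp: less_eq_bounded_op_def op_positive_iff op_apply_simps cinner_diff_left
          complex_eq_iff intro: antisym)
    then have "X - Y = 0" by (rule bounded_op_eq_0I)
    then show ?thesis by simp
  qed
  show "Z + X \<le> Z + Y" if "X \<le> Y"
    using that by (simp add: less_eq_bounded_op_def)
qed

end

definition positive_map ::
  "('a::complex_hilbert bounded_op \<Rightarrow> 'b::complex_hilbert bounded_op) \<Rightarrow> bool"
  where "positive_map \<Phi> \<longleftrightarrow> (\<forall>X. 0 \<le> X \<longrightarrow> 0 \<le> \<Phi> X)"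

definition op_invertible :: "'a::complex_hilbert bounded_op \<Rightarrow> bool"
  where "op_invertible X \<longleftrightarrow> (\<exists>Y. X * Y = 1 \<and> Y * X = 1)"

definition op_spectrum :: "'a::complex_hilbert bounded_op \<Rightarrow> complex set"
  where "op_spectrum X = {z. \<not> op_invertible (X - z *\<^sub>C 1)}"

definition op_poly :: "real poly \<Rightarrow> 'a::complex_hilbert bounded_op \<Rightarrow> 'a bounded_op"
  where "op_poly p X = (\<Sum>i\<le>degree p. coeff p i *\<^sub>R X ^ i)"

text \<open>For self-adjoint \<open>X\<close> (whose spectrum is real) and \<open>f\<close> continuous on the spectrum, \<open>f(X)\<close> is
  the norm limit of \<open>p\<^sub>n(X)\<close> for any polynomials \<open>p\<^sub>n\<close> converging to \<open>f\<close> uniformly on the spectrum.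
  For other \<open>X\<close> or \<open>f\<close> the value is unspecified.\<close>

definition op_cfc :: "(real \<Rightarrow> real) \<Rightarrow> 'a::complex_hilbert bounded_op \<Rightarrow> 'a bounded_op"
  where "op_cfc f X = (THE T. \<forall>p :: nat \<Rightarrow> real poly.
    uniform_limit {x. complex_of_real x \<in> op_spectrum X} (\<lambda>n. poly (p n)) f sequentially
      \<longrightarrow> (\<lambda>n. op_poly (p n) X) \<longlonglongrightarrow> T)"

text \<open>Only used for positive invertible \<open>X\<close>, where the spectrum is bounded away from \<open>0\<close>; thus
  negative exponents are meaningful and the convention \<open>0 powr 0 = 0\<close> plays no role.\<close>

definition op_powr :: "'a::complex_hilbert bounded_op \<Rightarrow> real \<Rightarrow> 'a bounded_op"
  where "op_powr X s = op_cfc (\<lambda>x. x powr s) X"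

definition geo_mean_inv ::
  "'a::complex_hilbert bounded_op \<Rightarrow> real \<Rightarrow> 'a bounded_op \<Rightarrow> 'a bounded_op"
  where "geo_mean_inv A u B =
    op_powr A (1/2) * op_powr (op_powr A (-1/2) * B * op_powr A (-1/2)) u * op_powr A (1/2)"

text \<open>If \<open>A\<close> or \<open>B\<close> is not invertible, the mean is the limit in the strong operator topology, i.e.
  pointwise on vectors, of the means of \<open>A + \<epsilon>I\<close> and \<open>B + \<epsilon>I\<close> as \<open>\<epsilon>\<close> decreases to \<open>0\<close>.\<close>

definition geo_mean ::
  "'a::complex_hilbert bounded_op \<Rightarrow> real \<Rightarrow> 'a bounded_op \<Rightarrow> 'a bounded_op"
  (\<open>(_ \<sharp>\<^bsub>_\<^esub> _)\<close> [71, 0, 71] 70)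
  where "A \<sharp>\<^bsub>u\<^esub> B =
    (if op_invertible A \<and> op_invertible B then geo_mean_inv A u B
     else THE S. \<forall>x. ((\<lambda>\<epsilon>. op_apply (geo_mean_inv (A + \<epsilon> *\<^sub>R 1) u (B + \<epsilon> *\<^sub>R 1)) x)
       \<longlongrightarrow> op_apply S x) (at_right 0))"

abbreviation geo_mean_half ::
  "'a::complex_hilbert bounded_op \<Rightarrow> 'a bounded_op \<Rightarrow> 'a bounded_op"  (infix \<open>\<sharp>\<close> 70)
  where "A \<sharp> B \<equiv> A \<sharp>\<^bsub>1/2\<^esub> B"

end

theory Submission
  imports Defs "HOL-Computational_Algebra.Fundamental_Theorem_Algebra"
begin

text \<open>For \<open>0 < x\<close> the weighted power \<open>x powr t\<close> satisfies a refined Young inequality and a refined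
  reverse Young inequality, both linear in \<open>1\<close>, \<open>x\<close> and powers of \<open>x\<close>. Functional calculus at
  \<open>A\<^sup>-\<^sup>1\<^sup>/\<^sup>2 B A\<^sup>-\<^sup>1\<^sup>/\<^sup>2\<close> turns such an inequality into one between geometric means. The upper bound is
  used for the pair \<open>\<Phi>(A), \<Phi>(B)\<close>, the lower one for \<open>A, B\<close> before applying \<open>\<Phi>\<close>; their difference,
  plus \<open>r\<close> times the arithmetic-geometric mean inequality for \<open>\<Phi>(A), \<Phi>(B)\<close>, is the claim.

  If \<open>\<Phi>(A)\<close> or \<open>\<Phi>(B)\<close> is not invertible, the inequality passes to the strong limit. The limit
  exists because the mean is jointly monotone. The functions \<open>f\<close> with jointly monotone
  mean are closed under sums, parallel sums and locally uniform limits, hence by the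
  arithmetic-harmonic iteration under \<open>(f, g) \<mapsto> \<surd>(f g)\<close>; starting from \<open>1\<close> and \<open>x\<close> this gives all
  \<open>x powr u\<close> with \<open>0 \<le> u \<le> 1\<close>.\<close>

section \<open>Quadratic forms and order\<close>

text \<open>Both scalar inequalities come from convexity of \<open>x powr t\<close> in the exponent.
  For \<open>0 < t <= 1/2\<close> the upper bound interpolates linearly between the exponents
  \<open>0\<close>, \<open>1/4\<close> and \<open>1/2\<close>, and \<open>r0\<close> is a tent
  function peaking at the middle node. The lower bound is
  \<open>x powr t >= 2 * x powr (1/2) - x powr (1 - t)\<close>, followed by the same interpolation
  of \<open>x powr (1 - t)\<close> between \<open>1/2\<close>, \<open>3/4\<close> and
  \<open>1\<close>. This is why the quarter mean of the images appears together with the image of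
  the three-quarter mean. For \<open>t > 1/2\<close> replacing \<open>x\<close> by
  \<open>1/x\<close> and multiplying by \<open>x\<close> reflects all exponents. The other obstacle
  is that \<open>op_cfc\<close> and \<open>geo_mean\<close> are definite descriptions and say
  nothing until a unique limit is shown to exist. For \<open>op_cfc\<close> everything rests on one
  fact: a real polynomial that is nonnegative on the spectrum of a self-adjoint operator gives a
  nonnegative operator. It is obtained by factoring the polynomial and using that an operator whose
  positive shifts are all invertible is nonnegative.\<close>

definition op_qform :: "'a::complex_hilbert bounded_op \<Rightarrow> 'a \<Rightarrow> real"
  where "op_qform X x = Re (cinner (op_apply X x) x)"

definition op_selfadj :: "'a::complex_hilbert bounded_op \<Rightarrow> bool"
  where "op_selfadj X \<longleftrightarrow> (\<forall>x y. cinner (op_apply X x) y = cinner x (op_apply X y))"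

lemma cinner_diff_right: "cinner x (y - z) = cinner x y - cinner x (z :: 'a::complex_hilbert)"
  by (metis cinner_commute cinner_diff_left complex_cnj_diff)

lemma cinner_scaleR_left: "cinner (c *\<^sub>R x) y = of_real c * cinner x (y :: 'a::complex_hilbert)"
  by (simp add: scaleR_scaleC cinner_scaleC_left)

lemma cinner_scaleR_right: "cinner x (c *\<^sub>R y) = of_real c * cinner x (y :: 'a::complex_hilbert)"
  by (simp add: scaleR_scaleC cinner_scaleC_right)

lemma Re_cinner_commute: "Re (cinner x y) = Re (cinner y (x :: 'a::complex_hilbert))"
  by (metis cinner_commute complex_cnj(1) cnj.simps(1))

lemma Re_cinner_self: "Re (cinner x x) = (norm (x :: 'a::complex_hilbert))\<^sup>2"
  by (simp add: cinner_self)

text \<open>The class provides the norm with its triangle inequality, so Cauchy-Schwarz is read off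
  by expanding the squared norm of \<open>x + y\<close>.\<close>

lemma Re_cinner_le: "Re (cinner x y) \<le> norm x * norm (y :: 'a::complex_hilbert)"
proof -
  have "(norm (x + y))\<^sup>2 = (norm x)\<^sup>2 + 2 * Re (cinner x y) + (norm y)\<^sup>2"
    unfolding Re_cinner_self[symmetric]
    using Re_cinner_commute[of x y] by (simp add: cinner_add_left cinner_add_right)
  moreover have "(norm (x + y))\<^sup>2 \<le> (norm x + norm y)\<^sup>2"
    by (intro power_mono norm_triangle_ineq) simp
  ultimately show ?thesis by (simp add: power2_sum)
qed

lemma abs_Re_cinner_le: "\<bar>Re (cinner x y)\<bar> \<le> norm x * norm (y :: 'a::complex_hilbert)"
  using Re_cinner_le[of x y] Re_cinner_le[of "- x" y] by (simp add: cinner_minus_left)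

lemma norm_op_apply_le: "norm (op_apply X x) \<le> norm X * norm x"
  unfolding norm_bounded_op.rep_eq by (rule onorm[OF bounded_linear_op_apply])

lemma norm_bounded_op_leI:
  assumes "0 \<le> c" "\<And>x. norm (op_apply X x) \<le> c * norm x"
  shows "norm X \<le> c"
  unfolding norm_bounded_op.rep_eq by (rule onorm_bound) (use assms in auto)

lemma bounded_linear_op_apply_left: "bounded_linear (\<lambda>X. op_apply X x)"
  by (rule bounded_linear_intro[where K = "norm x"])
    (simp_all add: op_apply_simps norm_op_apply_le mult.commute[of "norm x"])

lemma op_qform_add: "op_qform (X + Y) x = op_qform X x + op_qform Y x"
  and op_qform_diff: "op_qform (X - Y) x = op_qform X x - op_qform Y x"
  and op_qform_minus: "op_qform (- X) x = - op_qform X x"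
  and op_qform_scaleR: "op_qform (c *\<^sub>R X) x = c * op_qform X x"
  and op_qform_one: "op_qform 1 x = (norm x)\<^sup>2"
  and op_qform_zero: "op_qform 0 x = 0"
  by (simp_all add: op_qform_def op_apply_simps cinner_add_left cinner_diff_left
      cinner_minus_left cinner_scaleR_left cinner_zero_left Re_cinner_self)

lemmas op_qform_simps = op_qform_add op_qform_diff op_qform_minus op_qform_scaleR op_qform_one
  op_qform_zero

lemma abs_op_qform_le: "\<bar>op_qform X x\<bar> \<le> norm X * (norm x)\<^sup>2"
proof -
  have "\<bar>op_qform X x\<bar> \<le> norm (op_apply X x) * norm x"
    unfolding op_qform_def by (rule abs_Re_cinner_le)
  also have "\<dots> \<le> norm X * norm x * norm x"
    by (intro mult_right_mono norm_op_apply_le) simp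
  finally show ?thesis by (simp add: power2_eq_square)
qed

lemma op_selfadj_zero: "op_selfadj 0"
  unfolding op_selfadj_def op_apply_simps cinner_zero_left
  by (metis cinner_commute cinner_zero_left complex_cnj_zero)

lemma op_selfadj_one: "op_selfadj 1"
  by (simp add: op_selfadj_def op_apply_simps)

lemma op_selfadj_add: "op_selfadj X \<Longrightarrow> op_selfadj Y \<Longrightarrow> op_selfadj (X + Y)"
  by (simp add: op_selfadj_def op_apply_simps cinner_add_left cinner_add_right)

lemma op_selfadj_diff: "op_selfadj X \<Longrightarrow> op_selfadj Y \<Longrightarrow> op_selfadj (X - Y)"
  by (simp add: op_selfadj_def op_apply_simps cinner_diff_left cinner_diff_right)

lemma op_selfadj_scaleR: "op_selfadj X \<Longrightarrow> op_selfadj (c *\<^sub>R X)"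
  by (simp add: op_selfadj_def op_apply_simps cinner_scaleR_left cinner_scaleR_right)

lemma op_selfadj_times:
  "op_selfadj X \<Longrightarrow> op_selfadj Y \<Longrightarrow> X * Y = Y * X \<Longrightarrow> op_selfadj (X * Y)"
  by (metis op_selfadj_def times_bounded_op.rep_eq)

lemma op_selfadj_conj: "op_selfadj S \<Longrightarrow> op_selfadj X \<Longrightarrow> op_selfadj (S * X * S)"
  by (simp add: op_selfadj_def op_apply_simps)

text \<open>Polarization: the defect \<open>d\<close> of self-adjointness is sesquilinear and
  vanishes on the diagonal, and its values at \<open>x + y\<close> and
  \<open>x + \<i> *\<^sub>C y\<close> then force \<open>d x y = 0\<close>.\<close>

lemma op_positive_selfadj:
  assumes "op_positive X"
  shows "op_selfadj X"
  unfolding op_selfadj_def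
proof (intro allI)
  fix x y
  define d where "d u v = cinner (op_apply X u) v - cinner u (op_apply X v)" for u v
  have add: "d (u + v) w = d u w + d v w" "d w (u + v) = d w u + d w v"
    and scale: "d (c *\<^sub>C u) v = c * d u v" "d u (c *\<^sub>C v) = cnj c * d u v" for u v w c
    by (simp_all add: d_def op_apply_add op_apply_scaleC cinner_add_left cinner_add_right
        cinner_scaleC_left cinner_scaleC_right algebra_simps)
  have diag: "d u u = 0" for u
    using assms cinner_commute[of u "op_apply X u"]
    by (auto simp: d_def op_positive_iff complex_eq_iff)
  have "d x y + d y x = d (x + y) (x + y)"
    by (simp only: add) (simp add: diag)
  moreover have "\<i> * (d y x - d x y) = d (x + \<i> *\<^sub>C y) (x + \<i> *\<^sub>C y)"
    by (simp only: add scale) (simp add: diag algebra_simps)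
  ultimately have "d x y = 0" by (simp add: diag)
  then show "cinner (op_apply X x) y = cinner x (op_apply X y)" by (simp add: d_def)
qed

lemma op_selfadj_Im: "op_selfadj X \<Longrightarrow> Im (cinner (op_apply X x) x) = 0"
  by (metis op_selfadj_def cinner_commute Reals_cnj_iff complex_is_Real_iff)

text \<open>Self-adjointness of the difference takes care of the imaginary part of the form, so that
  an order proof splits into an algebraic check and a real inequality.\<close>

lemma le_bounded_op_iff: "X \<le> Y \<longleftrightarrow> op_selfadj (Y - X) \<and> (\<forall>x. op_qform X x \<le> op_qform Y x)"
proof
  assume "X \<le> Y"
  then have *: "op_positive (Y - X)" by (simp add: less_eq_bounded_op_def)
  moreover have "0 \<le> op_qform (Y - X) x" for x
    using * by (simp add: op_positive_iff op_qform_def)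
  ultimately show "op_selfadj (Y - X) \<and> (\<forall>x. op_qform X x \<le> op_qform Y x)"
    by (simp add: op_positive_selfadj op_qform_simps)
next
  assume *: "op_selfadj (Y - X) \<and> (\<forall>x. op_qform X x \<le> op_qform Y x)"
  then have "0 \<le> op_qform (Y - X) x" for x by (simp add: op_qform_simps)
  with * show "X \<le> Y"
    by (simp add: less_eq_bounded_op_def op_positive_iff op_selfadj_Im op_qform_def)
qed

lemma op_nonneg_iff: "0 \<le> X \<longleftrightarrow> op_selfadj X \<and> (\<forall>x. 0 \<le> op_qform X x)"
  by (simp add: le_bounded_op_iff op_qform_simps)

lemma op_selfadjI: "0 \<le> X \<Longrightarrow> op_selfadj X"
  by (simp add: op_nonneg_iff)

instance bounded_op :: (complex_hilbert) ordered_real_vector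
proof
  fix X Y :: "'a bounded_op" and a b :: real
  show "a *\<^sub>R X \<le> a *\<^sub>R Y" if "X \<le> Y" "0 \<le> a"
    using that op_selfadj_scaleR[of "Y - X" a]
    by (auto simp: le_bounded_op_iff op_qform_simps mult_left_mono scaleR_diff_right)
  show "a *\<^sub>R X \<le> b *\<^sub>R X" if "a \<le> b" "0 \<le> X"
    using that op_selfadj_scaleR[of X "b - a"]
    by (auto simp: le_bounded_op_iff op_nonneg_iff op_qform_simps mult_right_mono scaleR_diff_left)
qed

lemma op_nonneg_one: "0 \<le> (1 :: 'a::complex_hilbert bounded_op)"
  by (simp add: op_nonneg_iff op_selfadj_one op_qform_simps)

lemma op_qform_conj:
  "op_selfadj S \<Longrightarrow> op_qform (S * X * S) x = op_qform X (op_apply S x)"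
  by (simp add: op_qform_def op_selfadj_def op_apply_simps)

lemma op_conj_mono:
  assumes "op_selfadj S" "X \<le> Y"
  shows "S * X * S \<le> S * Y * S"
proof -
  have "op_selfadj (S * Y * S - S * X * S)"
    using op_selfadj_conj[of S "Y - X"] assms by (simp add: le_bounded_op_iff algebra_simps)
  then show ?thesis using assms by (simp add: le_bounded_op_iff op_qform_conj)
qed

lemma op_conj_nonneg: "op_selfadj S \<Longrightarrow> 0 \<le> X \<Longrightarrow> 0 \<le> S * X * S"
  using op_conj_mono[of S 0 X] by simp

lemma op_qform_square: "op_selfadj S \<Longrightarrow> op_qform (S * S) x = (norm (op_apply S x))\<^sup>2"
  using op_qform_conj[of S 1 x] by (simp add: op_qform_simps)

lemma op_square_nonneg: "op_selfadj S \<Longrightarrow> 0 \<le> S * S"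
  using op_conj_nonneg[of S 1] by (simp add: op_nonneg_one)

lemma op_selfadj_le_norm: "op_selfadj X \<Longrightarrow> X \<le> norm X *\<^sub>R 1"
  using abs_op_qform_le[of X]
  by (auto simp: le_bounded_op_iff op_qform_simps op_selfadj_diff op_selfadj_scaleR op_selfadj_one
      abs_le_iff)

lemma op_scaleR_one_mono: "a \<le> b \<Longrightarrow> a *\<^sub>R (1 :: 'a::complex_hilbert bounded_op) \<le> b *\<^sub>R 1"
  by (intro scaleR_right_mono op_nonneg_one)

text \<open>The form of \<open>T\<close> is nonnegative at \<open>x - T x / d\<close>.\<close>
lemma norm_op_apply_square_le:
  assumes T: "0 \<le> T" "T \<le> d *\<^sub>R 1" and d: "0 < d"
  shows "(norm (op_apply T x))\<^sup>2 \<le> d * op_qform T x"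
proof -
  let ?y = "op_apply T x"
  have sa: "cinner (op_apply T u) v = cinner u (op_apply T v)" for u v
    using op_selfadjI[OF T(1)] by (simp add: op_selfadj_def)
  have "0 \<le> op_qform T (x - (1 / d) *\<^sub>R ?y)"
    using T by (simp add: op_nonneg_iff)
  also have "\<dots> = op_qform T x - 2 / d * (norm ?y)\<^sup>2 + (1 / d)\<^sup>2 * op_qform T ?y"
  proof -
    have lin: "op_apply T (x - c *\<^sub>R ?y) = ?y - c *\<^sub>R op_apply T ?y" for c
      by (simp add: bounded_linear_op_apply linear_diff bounded_linear.linear linear_cmul)
    define p q m where "p = Re (cinner ?y x)" and "q = Re (cinner ?y ?y)"
      and "m = Re (cinner (op_apply T ?y) ?y)"
    have "op_qform T (x - c *\<^sub>R ?y)
        = p - c * Re (cinner (op_apply T ?y) x) - c * (q - c * m)" for c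
      unfolding op_qform_def lin cinner_diff_left cinner_diff_right cinner_scaleR_left
        cinner_scaleR_right p_def q_def m_def by simp
    moreover have "Re (cinner (op_apply T ?y) x) = q" by (simp only: sa[of ?y x] q_def)
    ultimately have "op_qform T (x - c *\<^sub>R ?y) = p - 2 * c * q + c\<^sup>2 * m" for c
      by (simp add: power2_eq_square algebra_simps)
    then have "op_qform T (x - c *\<^sub>R ?y)
        = op_qform T x - 2 * c * (norm ?y)\<^sup>2 + c\<^sup>2 * op_qform T ?y" for c
      by (simp only: p_def q_def m_def op_qform_def Re_cinner_self)
    from this[of "1 / d"] show ?thesis by simp
  qed
  finally have "2 / d * (norm ?y)\<^sup>2 \<le> op_qform T x + (1 / d)\<^sup>2 * op_qform T ?y" by simp
  also have "(1 / d)\<^sup>2 * op_qform T ?y \<le> (1 / d)\<^sup>2 * (d * (norm ?y)\<^sup>2)"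
    using T by (intro mult_left_mono) (simp_all add: le_bounded_op_iff op_qform_simps)
  also have "\<dots> = 1 / d * (norm ?y)\<^sup>2" using d by (simp add: power2_eq_square)
  finally have "1 / d * (norm ?y)\<^sup>2 \<le> op_qform T x" by simp
  then show ?thesis using d by (simp add: pos_divide_le_eq mult.commute)
qed

text \<open>Turns order bounds into norm bounds, by applying the form bound once more after
  \<open>norm_op_apply_square_le\<close>.\<close>

lemma norm_op_le:
  fixes T :: "'a::complex_hilbert bounded_op"
  assumes "0 \<le> T" "T \<le> d *\<^sub>R 1" "0 < d"
  shows "norm T \<le> d"
proof (rule norm_bounded_op_leI)
  fix x
  have "(norm (op_apply T x))\<^sup>2 \<le> d * op_qform T x"
    by (rule norm_op_apply_square_le[OF assms])
  also have "\<dots> \<le> d * (d * (norm x)\<^sup>2)"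
    using assms by (intro mult_left_mono) (simp_all add: le_bounded_op_iff op_qform_simps)
  also have "\<dots> = (d * norm x)\<^sup>2" by (simp add: power2_eq_square)
  finally show "norm (op_apply T x) \<le> d * norm x"
    by (rule power2_le_imp_le) (use assms(3) in simp)
qed (rule less_imp_le[OF assms(3)])

section \<open>Strong limits and completeness\<close>

lemma op_apply_linear: "linear (op_apply X)"
  by (simp add: bounded_linear_op_apply bounded_linear.linear)

lemma tendsto_cinner_left:
  assumes "(f \<longlongrightarrow> l) F"
  shows "((\<lambda>i. cinner (f i) y) \<longlongrightarrow> cinner l (y :: 'a::complex_hilbert)) F"
proof -
  have Re: "((\<lambda>i. Re (cinner (f i) z)) \<longlongrightarrow> Re (cinner l z)) F" for z
  proof (rule Lim_null[THEN iffD2], rule Lim_null_comparison)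
    show "\<forall>\<^sub>F i in F. norm (Re (cinner (f i) z) - Re (cinner l z)) \<le> norm (f i - l) * norm z"
      using abs_Re_cinner_le[of "f _ - l" z] by (simp add: cinner_diff_left)
    show "((\<lambda>i. norm (f i - l) * norm z) \<longlongrightarrow> 0) F"
      using Lim_null[THEN iffD1, OF assms] by (intro tendsto_mult_left_zero tendsto_norm_zero)
  qed
  \<comment> \<open>Rotating the second argument by \<open>\<i>\<close> reduces imaginary parts to
    real parts.\<close>
  have "Im (cinner u y) = Re (cinner u (\<i> *\<^sub>C y))" for u
    by (simp add: cinner_scaleC_right)
  with Re[of y] Re[of "\<i> *\<^sub>C y"] show ?thesis by (simp add: tendsto_complex_iff)
qed

lemma op_nonneg_tendsto_strong:
  fixes X :: "'b \<Rightarrow> 'a::complex_hilbert bounded_op"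
  assumes lim: "\<And>x. ((\<lambda>i. op_apply (X i) x) \<longlongrightarrow> op_apply L x) F"
    and "F \<noteq> bot" and ev: "eventually (\<lambda>i. 0 \<le> X i) F"
  shows "0 \<le> L"
proof -
  have "cinner (op_apply L x) x \<in> \<real>\<^sub>\<ge>\<^sub>0" for x
  proof (rule Lim_in_closed_set[OF closed_nonneg_Reals_complex _ assms(2) tendsto_cinner_left[OF lim]])
    show "\<forall>\<^sub>F i in F. cinner (op_apply (X i) x) x \<in> \<real>\<^sub>\<ge>\<^sub>0"
      using ev by eventually_elim (simp add: less_eq_bounded_op_def op_positive_def)
  qed
  then show ?thesis by (simp add: less_eq_bounded_op_def op_positive_def)
qed

lemma op_nonneg_tendsto:
  fixes X :: "'b \<Rightarrow> 'a::complex_hilbert bounded_op"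
  assumes "(X \<longlongrightarrow> L) F" "F \<noteq> bot" "eventually (\<lambda>i. 0 \<le> X i) F"
  shows "0 \<le> L"
  using bounded_linear.tendsto[OF bounded_linear_op_apply_left assms(1)] assms(2,3)
  by (rule op_nonneg_tendsto_strong)

text \<open>The bound may set in at a different stage for each \<open>x\<close>; the common constant
  \<open>c\<close> is what makes the limit a bounded operator.\<close>

lemma strong_limit_exists:
  fixes X :: "'b \<Rightarrow> 'a::complex_hilbert bounded_op"
  assumes lim: "\<And>x. ((\<lambda>i. op_apply (X i) x) \<longlongrightarrow> L x) F" and F: "F \<noteq> bot"
    and bound: "\<And>x. eventually (\<lambda>i. norm (op_apply (X i) x) \<le> c * norm x) F"
  shows "\<exists>S. \<forall>x. op_apply S x = L x"
proof -
  have add: "L (x + y) = L x + L y" for x y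
    using tendsto_unique[OF F lim[of "x + y"]] tendsto_add[OF lim[of x] lim[of y]]
    by (simp add: op_apply_add)
  have scale: "L (a *\<^sub>C x) = a *\<^sub>C L x" for a x
    using tendsto_unique[OF F lim[of "a *\<^sub>C x"]]
      bounded_linear.tendsto[OF bounded_linear_scaleC lim[of x]]
    by (simp add: op_apply_scaleC)
  have "norm (L x) \<le> c * norm x" for x
    by (rule tendsto_upperbound[OF tendsto_norm[OF lim] bound F])
  then have "bounded_linear L"
    by (intro bounded_linear_intro[where K = c]) (simp_all add: add scale scaleR_scaleC mult.commute)
  then have "op_apply (Bounded_op L) = L"
    by (intro Bounded_op_inverse) (simp add: clinear_iff add scale)
  then show ?thesis by metis
qed

text \<open>Completeness supplies the fixed points that give inverses and the norm limits of the
  functional calculus.\<close>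

instance bounded_op :: (complex_hilbert) banach
proof
  fix X :: "nat \<Rightarrow> 'a bounded_op"
  assume C: "Cauchy X"
  have le: "norm (op_apply (X m) x - op_apply (X n) x) \<le> dist (X m) (X n) * norm x" for m n x
    using norm_op_apply_le[of "X m - X n" x] by (simp add: op_apply_simps dist_norm)
  have "Cauchy (\<lambda>n. op_apply (X n) x)" for x
    by (rule bounded_linear.Cauchy[OF bounded_linear_op_apply_left C])
  then have "convergent (\<lambda>n. op_apply (X n) x)" for x
    by (rule Cauchy_convergent)
  then obtain L where L: "\<And>x. (\<lambda>n. op_apply (X n) x) \<longlonglongrightarrow> L x"
    unfolding convergent_def by metis
  obtain c where c: "\<And>n. norm (X n) \<le> c"
    using Cauchy_Bseq[OF C] by (auto simp: Bseq_def)
  have "norm (op_apply (X n) x) \<le> c * norm x" for n x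
    using norm_op_apply_le[of "X n" x] mult_right_mono[OF c[of n], of "norm x"] by simp
  then obtain S where S: "\<And>x. op_apply S x = L x"
    using strong_limit_exists[OF L sequentially_bot, of c] by auto
  have "X \<longlonglongrightarrow> S"
  proof (rule metric_LIMSEQ_I)
    fix e :: real assume "0 < e"
    then obtain N where N: "\<And>m n. m \<ge> N \<Longrightarrow> n \<ge> N \<Longrightarrow> dist (X m) (X n) < e / 2"
      using metric_CauchyD[OF C, of "e / 2"] by auto
    have "dist (X n) S \<le> e / 2" if n: "n \<ge> N" for n
      unfolding dist_norm
    proof (rule norm_bounded_op_leI)
      fix x
      have "(\<lambda>m. norm (op_apply (X n) x - op_apply (X m) x)) \<longlonglongrightarrow> norm (op_apply (X n) x - L x)"
        by (intro tendsto_intros L)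
      moreover have "\<forall>\<^sub>F m in sequentially. norm (op_apply (X n) x - op_apply (X m) x) \<le> e / 2 * norm x"
        using eventually_ge_at_top[of N]
      proof eventually_elim
        case (elim m)
        then show ?case
          using le[of n x m] mult_right_mono[OF less_imp_le[OF N[OF n elim]], of "norm x"] by simp
      qed
      ultimately show "norm (op_apply (X n - S) x) \<le> e / 2 * norm x"
        unfolding op_apply_simps S by (rule tendsto_upperbound) simp
    qed (use \<open>0 < e\<close> in simp)
    then show "\<exists>N. \<forall>n\<ge>N. dist (X n) S < e"
      using \<open>0 < e\<close> by (intro exI[of _ N]) force
  qed
  then show "convergent X" by (rule convergentI)
qed

section \<open>Invertibility and lower bounds\<close>

text \<open>Scaled by \<open>c\<close>, the operator is \<open>1 - Z\<close> with \<open>Z\<close>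
  of norm below \<open>1\<close>. Fixed points of the contractions \<open>1 + Z * T\<close> and
  \<open>1 + T * Z\<close> replace the Neumann series and give a right and a left inverse.\<close>

lemma op_invertibleI_bounded_below:
  fixes Y :: "'a::complex_hilbert bounded_op"
  assumes a: "0 < a" "a *\<^sub>R 1 \<le> Y"
  shows "op_invertible Y"
proof -
  define c where "c = max a (norm Y)"
  define Z where "Z = 1 - (1 / c) *\<^sub>R Y"
  have c: "0 < c" "a \<le> c" using a by (auto simp: c_def)
  have sa: "op_selfadj Y"
    using op_selfadj_add[of "Y - a *\<^sub>R 1" "a *\<^sub>R 1"] a
    by (simp add: le_bounded_op_iff op_selfadj_scaleR op_selfadj_one)
  have "Y \<le> c *\<^sub>R 1"
    by (rule order_trans[OF op_selfadj_le_norm[OF sa] op_scaleR_one_mono]) (simp add: c_def)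
  from scaleR_left_mono[OF this, of "1 / c"] have "0 \<le> Z"
    using c by (simp add: Z_def)
  have "Z \<le> (1 - a / c) *\<^sub>R 1"
    using scaleR_left_mono[OF a(2), of "1 / c"] c by (simp add: Z_def scaleR_diff_left)
  \<comment> \<open>\<open>1 - a / c\<close> vanishes if \<open>a = c\<close>, while
    \<open>norm_op_le\<close> asks for a positive bound; halving keeps the constant strictly between
    \<open>0\<close> and \<open>1\<close>.\<close>
  also have "\<dots> \<le> (1 - a / (2 * c)) *\<^sub>R 1"
    using a c by (intro op_scaleR_one_mono) (simp add: field_simps)
  finally have Zle: "norm Z \<le> 1 - a / (2 * c)"
    using \<open>0 \<le> Z\<close> a c by (intro norm_op_le) (auto simp: field_simps)
  have fix_ex: "\<exists>T. f T = T" if f: "\<And>S T. norm (f S - f T) \<le> norm Z * norm (S - T)"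
    for f :: "'a bounded_op \<Rightarrow> 'a bounded_op"
  proof -
    have "dist (f S) (f T) \<le> (1 - a / (2 * c)) * dist S T" for S T
      unfolding dist_norm by (rule order_trans[OF f mult_right_mono[OF Zle]]) simp
    moreover have "0 \<le> 1 - a / (2 * c)" "1 - a / (2 * c) < 1"
      using a c by (simp_all add: field_simps)
    ultimately have "\<exists>!T. f T = T" using banach_fix_type[of "1 - a / (2 * c)" f] by blast
    then show ?thesis by blast
  qed
  obtain R where R: "1 + Z * R = R"
  proof -
    have "norm (1 + Z * S - (1 + Z * T)) \<le> norm Z * norm (S - T)" for S T
      using norm_mult_ineq[of Z "S - T"] by (simp add: right_diff_distrib)
    from fix_ex[of "\<lambda>T. 1 + Z * T", OF this] show ?thesis using that by blast
  qed
  obtain L where L: "1 + L * Z = L"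
  proof -
    have "norm (1 + S * Z - (1 + T * Z)) \<le> norm Z * norm (S - T)" for S T
      using norm_mult_ineq[of "S - T" Z] by (simp add: left_diff_distrib mult.commute)
    from fix_ex[of "\<lambda>T. 1 + T * Z", OF this] show ?thesis using that by blast
  qed
  have Y: "Y = c *\<^sub>R (1 - Z)" using c by (simp add: Z_def)
  have "(1 - Z) * R = 1" "L * (1 - Z) = 1" using R L by (simp_all add: algebra_simps)
  then have "Y * ((1 / c) *\<^sub>R R) = 1" "((1 / c) *\<^sub>R L) * Y = 1"
    using c by (simp_all add: Y)
  moreover have "L = R"
    using mult.assoc[of L "1 - Z" R] unfolding \<open>(1 - Z) * R = 1\<close> \<open>L * (1 - Z) = 1\<close> by simp
  ultimately show ?thesis unfolding op_invertible_def by blast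
qed

text \<open>A left inverse bounds \<open>norm x\<close> by a multiple of the norm of
  \<open>X x\<close>, whose square is at most \<open>d\<close> times the form of
  \<open>X\<close>.\<close>

lemma op_invertible_bounded_below:
  fixes X :: "'a::complex_hilbert bounded_op"
  assumes "0 \<le> X" "op_invertible X"
  shows "\<exists>a>0. a *\<^sub>R 1 \<le> X"
proof -
  obtain Y where Y: "Y * X = 1" using assms(2) by (auto simp: op_invertible_def)
  \<comment> \<open>The added \<open>1\<close> keeps both constants positive even when the norms
    vanish.\<close>
  define d k where "d = norm X + 1" and "k = norm Y + 1"
  have d: "0 < d" and k: "0 < k" by (simp_all add: d_def k_def add_nonneg_pos)
  have le: "X \<le> d *\<^sub>R 1"
    by (rule order_trans[OF op_selfadj_le_norm[OF op_selfadjI[OF assms(1)]] op_scaleR_one_mono])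
      (simp add: d_def)
  have "(norm x)\<^sup>2 / (k\<^sup>2 * d) \<le> op_qform X x" for x
  proof -
    have "norm x = norm (op_apply Y (op_apply X x))"
      by (metis Y one_bounded_op.rep_eq times_bounded_op.rep_eq)
    also have "\<dots> \<le> norm Y * norm (op_apply X x)" by (rule norm_op_apply_le)
    also have "\<dots> \<le> k * norm (op_apply X x)" by (intro mult_right_mono) (simp_all add: k_def)
    finally have "(norm x)\<^sup>2 \<le> k\<^sup>2 * (norm (op_apply X x))\<^sup>2"
      by (metis norm_ge_zero power_mono power_mult_distrib)
    also have "\<dots> \<le> k\<^sup>2 * (d * op_qform X x)"
      by (intro mult_left_mono norm_op_apply_square_le assms le d) simp
    finally show ?thesis using d k by (simp add: field_simps)
  qed
  then have "(1 / (k\<^sup>2 * d)) *\<^sub>R 1 \<le> X"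
    using op_selfadjI[OF assms(1)]
    by (auto simp: le_bounded_op_iff op_qform_simps op_selfadj_diff op_selfadj_scaleR op_selfadj_one)
  then show ?thesis using d k by (intro exI[of _ "1 / (k\<^sup>2 * d)"]) simp
qed

section \<open>Polynomials and the spectrum\<close>

lemma op_invertible_mult: "op_invertible X \<Longrightarrow> op_invertible Y \<Longrightarrow> op_invertible (X * Y)"
  unfolding op_invertible_def by (metis mult.assoc mult_1_left)

lemma op_invertible_scaleR:
  assumes "op_invertible X" "c \<noteq> 0"
  shows "op_invertible (c *\<^sub>R X)"
proof -
  from assms(1) obtain Y where "X * Y = 1" "Y * X = 1" by (auto simp: op_invertible_def)
  with assms(2) show ?thesis
    by (auto simp: op_invertible_def intro!: exI[of _ "(1 / c) *\<^sub>R Y"])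
qed

lemma op_invertible_one: "op_invertible 1"
  unfolding op_invertible_def by (metis mult_1_left)

lemma op_poly_altdef:
  assumes "degree p \<le> n"
  shows "op_poly p X = (\<Sum>i\<le>n. coeff p i *\<^sub>R X ^ i)"
  unfolding op_poly_def
  by (rule sum.mono_neutral_left) (use assms in \<open>auto simp: coeff_eq_0 not_le\<close>)

lemma op_poly_0: "op_poly 0 X = 0"
  by (simp add: op_poly_def)

lemma op_poly_add: "op_poly (p + q) X = op_poly p X + op_poly q X"
proof -
  let ?n = "max (degree p) (degree q)"
  have "op_poly (p + q) X = (\<Sum>i\<le>?n. coeff (p + q) i *\<^sub>R X ^ i)"
    by (intro op_poly_altdef degree_add_le) auto
  also have "\<dots> = op_poly p X + op_poly q X"
    by (simp add: op_poly_altdef[of p ?n] op_poly_altdef[of q ?n] scaleR_add_left sum.distrib)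
  finally show ?thesis .
qed

lemma op_poly_smult: "op_poly (smult c p) X = c *\<^sub>R op_poly p X"
  by (simp add: op_poly_altdef[of "smult c p" "degree p"] op_poly_def scaleR_right.sum degree_smult_le)

lemma op_poly_pCons: "op_poly (pCons a p) X = a *\<^sub>R 1 + X * op_poly p X"
proof -
  have "op_poly (pCons a p) X = (\<Sum>i\<le>Suc (degree p). coeff (pCons a p) i *\<^sub>R X ^ i)"
    by (rule op_poly_altdef[OF degree_pCons_le])
  also have "\<dots> = a *\<^sub>R 1 + (\<Sum>i\<le>degree p. coeff p i *\<^sub>R X ^ Suc i)"
    unfolding sum.atMost_Suc_shift by simp
  finally show ?thesis
    by (simp add: op_poly_def sum_distrib_left)
qed

lemma op_poly_diff: "op_poly (p - q) X = op_poly p X - op_poly q X"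
  using op_poly_add[of "p - q" q X] by simp

lemma op_poly_mult: "op_poly (p * q) X = op_poly p X * op_poly q X"
  by (induction p)
    (simp_all add: op_poly_0 op_poly_pCons op_poly_add op_poly_smult distrib_right mult.assoc)

lemma op_selfadj_power:
  assumes "op_selfadj X"
  shows "op_selfadj (X ^ n)"
proof (induction n)
  case (Suc n)
  show ?case
    unfolding power_Suc by (rule op_selfadj_times[OF assms Suc]) (simp add: power_commutes)
qed (simp add: op_selfadj_one)

lemma op_selfadj_sum: "(\<And>i. i \<in> I \<Longrightarrow> op_selfadj (f i)) \<Longrightarrow> op_selfadj (sum f I)"
  by (induction I rule: infinite_finite_induct) (auto simp: op_selfadj_zero op_selfadj_add)

lemma op_selfadj_poly: "op_selfadj X \<Longrightarrow> op_selfadj (op_poly p X)"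
  unfolding op_poly_def by (intro op_selfadj_sum op_selfadj_scaleR op_selfadj_power)

lemma of_real_op_spectrum_iff:
  "complex_of_real x \<in> op_spectrum X \<longleftrightarrow> \<not> op_invertible (X - x *\<^sub>R 1)"
  by (simp add: op_spectrum_def scaleR_scaleC)

lemma op_spectrum_bounds:
  assumes "a *\<^sub>R 1 \<le> X" "X \<le> b *\<^sub>R 1" "complex_of_real x \<in> op_spectrum X"
  shows "x \<in> {a..b}"
proof (rule ccontr)
  assume "x \<notin> {a..b}"
  then consider "x < a" | "b < x" by force
  then have "op_invertible (X - x *\<^sub>R 1)"
  proof cases
    case 1
    have "(a - x) *\<^sub>R 1 \<le> X - x *\<^sub>R 1"
      using assms(1) by (simp add: scaleR_diff_left)
    then show ?thesis
      by (rule op_invertibleI_bounded_below[rotated]) (use 1 in simp)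
  next
    case 2
    have "(x - b) *\<^sub>R 1 \<le> x *\<^sub>R 1 - X"
      using assms(2) by (simp add: scaleR_diff_left)
    then have "op_invertible (x *\<^sub>R 1 - X)"
      by (rule op_invertibleI_bounded_below[rotated]) (use 2 in simp)
    from op_invertible_scaleR[OF this, of "-1"] show ?thesis by simp
  qed
  with assms(3) show False by (simp add: of_real_op_spectrum_iff)
qed

text \<open>Accounts for a conjugate pair of nonreal roots with real part \<open>a\<close> and
  imaginary parts \<open>b\<close> and \<open>- b\<close>: their real quadratic factor is a square
  plus a positive scalar.\<close>

lemma op_invertible_quadratic:
  assumes "op_selfadj X" "b \<noteq> 0"
  shows "op_invertible ((X - a *\<^sub>R 1) * (X - a *\<^sub>R 1) + b\<^sup>2 *\<^sub>R 1)"
proof (rule op_invertibleI_bounded_below)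
  have "0 \<le> (X - a *\<^sub>R 1) * (X - a *\<^sub>R 1)"
    by (intro op_square_nonneg op_selfadj_diff assms op_selfadj_scaleR op_selfadj_one)
  then show "b\<^sup>2 *\<^sub>R 1 \<le> (X - a *\<^sub>R 1) * (X - a *\<^sub>R 1) + b\<^sup>2 *\<^sub>R 1" by simp
qed (use assms in simp)

lemma map_poly_of_real_mult:
  "map_poly complex_of_real (p * q) = map_poly of_real p * map_poly of_real q"
  by (intro poly_eqI) (simp add: coeff_map_poly coeff_mult)

lemma map_poly_of_real_add:
  "map_poly complex_of_real (p + q) = map_poly of_real p + map_poly of_real q"
  by (intro poly_eqI) (simp add: coeff_map_poly)

lemma poly_map_poly_of_real: "poly (map_poly complex_of_real p) (of_real x) = of_real (poly p x)"
  by (induction p) (simp_all add: map_poly_pCons)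

text \<open>The remainder modulo the quadratic is a real polynomial of degree at most
  \<open>1\<close> with a nonreal root, hence zero.\<close>

lemma quadratic_dvd_of_nonreal_root:
  fixes q :: "real poly"
  assumes root: "poly (map_poly complex_of_real q) z = 0" and z: "Im z \<noteq> 0"
  shows "[:(Re z)\<^sup>2 + (Im z)\<^sup>2, - 2 * Re z, 1:] dvd q"
proof -
  define d where "d = [:(Re z)\<^sup>2 + (Im z)\<^sup>2, - 2 * Re z, 1:]"
  define m where "m = q mod d"
  have dz: "poly (map_poly complex_of_real d) z = 0"
    unfolding d_def
    by (simp add: map_poly_pCons complex_eq_iff power2_eq_square algebra_simps)
  have "q = d * (q div d) + m" by (simp add: m_def)
  then have "poly (map_poly complex_of_real q) z
      = poly (map_poly complex_of_real (d * (q div d) + m)) z" by simp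
  then have mz: "poly (map_poly complex_of_real m) z = 0"
    by (simp add: map_poly_of_real_add map_poly_of_real_mult dz root)
  have "degree m < 2 \<or> m = 0"
    using degree_mod_less[of d q] by (auto simp: m_def d_def)
  then have "degree m \<le> 1" by auto
  then obtain u v where m: "m = [:u, v:]"
  proof -
    obtain u m' where "m = pCons u m'" by (cases m)
    moreover from this have "degree m' = 0"
      using \<open>degree m \<le> 1\<close> by (simp split: if_splits)
    then obtain v where "m' = [:v:]" by (rule degree_eq_zeroE)
    ultimately show ?thesis using that by simp
  qed
  have "v = 0" using mz z by (auto simp: m map_poly_pCons complex_eq_iff)
  then have "m = 0" using mz by (auto simp: m map_poly_pCons complex_eq_iff)
  then show ?thesis by (simp add: m_def d_def mod_eq_0_iff_dvd)
qed

text \<open>Only the real linear factors of \<open>q\<close> can obstruct invertibility, since the spectrum of a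
  self-adjoint operator is real.\<close>
lemma op_poly_invertible:
  assumes X: "op_selfadj X"
  shows "q \<noteq> 0 \<Longrightarrow> (\<And>x. complex_of_real x \<in> op_spectrum X \<Longrightarrow> poly q x \<noteq> 0)
    \<Longrightarrow> op_invertible (op_poly q X)"
proof (induction "degree q" arbitrary: q rule: less_induct)
  case less
  have factor: "op_invertible (op_poly q X)"
    if d: "d dvd q" "degree d > 0" "op_invertible (op_poly d X)" for d
  proof -
    obtain q' where q: "q = d * q'" using d(1) by blast
    have "op_invertible (op_poly q' X)"
    proof (rule less.hyps)
      show "degree q' < degree q" using less.prems(1) d(2) by (simp add: q degree_mult_eq)
    qed (use less.prems q in auto)
    then show ?thesis by (simp add: q op_poly_mult op_invertible_mult d(3))
  qed
  show ?case
  proof (cases "degree q = 0")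
    case True
    then obtain a where "q = [:a:]" by (metis degree_eq_zeroE)
    then show ?thesis
      using less.prems(1) by (simp add: op_poly_pCons op_poly_0 op_invertible_scaleR op_invertible_one)
  next
    case False
    then have "degree (map_poly complex_of_real q) \<noteq> 0" by (simp add: degree_map_poly)
    \<comment> \<open>Nonconstancy in the shape in which
      \<open>fundamental_theorem_of_algebra_alt\<close> asks for it.\<close>
    then have "\<nexists>a l. a \<noteq> 0 \<and> l = 0 \<and> map_poly complex_of_real q = pCons a l" by auto
    then obtain z where z: "poly (map_poly complex_of_real q) z = 0"
      using fundamental_theorem_of_algebra_alt by blast
    show ?thesis
    proof (cases "Im z = 0")
      case True
      then have "z = of_real (Re z)" by (simp add: complex_eq_iff)
      then have root: "poly q (Re z) = 0" by (metis poly_map_poly_of_real z of_real_eq_0_iff)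
      show ?thesis
      proof (rule factor)
        show "[:- Re z, 1:] dvd q" using root by (simp add: poly_eq_0_iff_dvd)
        have "op_invertible (X - Re z *\<^sub>R 1)"
          using less.prems(2) root by (auto simp: of_real_op_spectrum_iff)
        then show "op_invertible (op_poly [:- Re z, 1:] X)"
          by (simp add: op_poly_pCons op_poly_0)
      qed simp
    next
      case False
      show ?thesis
      proof (rule factor)
        show "[:(Re z)\<^sup>2 + (Im z)\<^sup>2, - 2 * Re z, 1:] dvd q"
          by (rule quadratic_dvd_of_nonreal_root[OF z False])
        have "op_poly [:(Re z)\<^sup>2 + (Im z)\<^sup>2, - 2 * Re z, 1:] X
            = (X - Re z *\<^sub>R 1) * (X - Re z *\<^sub>R 1) + (Im z)\<^sup>2 *\<^sub>R 1"
          by (simp add: op_poly_pCons op_poly_0 algebra_simps power2_eq_square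
              flip: scaleR_2)
        then show "op_invertible (op_poly [:(Re z)\<^sup>2 + (Im z)\<^sup>2, - 2 * Re z, 1:] X)"
          using op_invertible_quadratic[OF X False, of "Re z"] by simp
      qed simp
    qed
  qed
qed

lemma op_nonneg_epsilon:
  fixes Y :: "'a::complex_hilbert bounded_op"
  assumes "\<And>e. 0 < e \<Longrightarrow> 0 \<le> Y + e *\<^sub>R 1"
  shows "0 \<le> Y"
proof (rule op_nonneg_tendsto)
  have "(\<lambda>n. Y + inverse (real (Suc n)) *\<^sub>R 1) \<longlonglongrightarrow> Y + 0 *\<^sub>R 1"
    by (intro tendsto_intros LIMSEQ_inverse_real_of_nat)
  then show "(\<lambda>n. Y + inverse (real (Suc n)) *\<^sub>R 1) \<longlonglongrightarrow> Y" by simp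
qed (use assms in auto)

text \<open>If \<open>Y\<close> is not nonnegative, let \<open>c\<close> be the least shift making \<open>Y + c\<close> nonnegative; then
  \<open>Y + c\<close> is not bounded below, hence not invertible.\<close>
lemma op_nonneg_if_shifts_invertible:
  fixes Y :: "'a::complex_hilbert bounded_op"
  assumes sa: "op_selfadj Y" and inv: "\<And>c. 0 < c \<Longrightarrow> op_invertible (Y + c *\<^sub>R 1)"
  shows "0 \<le> Y"
proof -
  define C where "C = {c. 0 \<le> c \<and> 0 \<le> Y + c *\<^sub>R 1}"
  define c where "c = Inf C"
  have "- Y \<le> norm Y *\<^sub>R 1"
    using op_selfadj_le_norm[OF op_selfadj_scaleR[OF sa, of "-1"]] by simp
  from add_left_mono[OF this, of Y] have "0 \<le> Y + norm Y *\<^sub>R 1" by simp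
  then have ne: "C \<noteq> {}" unfolding C_def using norm_ge_zero by blast
  have bdd: "bdd_below C" by (auto simp: C_def)
  have "0 \<le> c" unfolding c_def by (rule cInf_greatest[OF ne]) (simp add: C_def)
  have c: "0 \<le> Y + c *\<^sub>R 1"
  proof (rule op_nonneg_epsilon)
    fix e :: real assume "0 < e"
    then obtain d where d: "d \<in> C" "d < c + e"
      using cInf_lessD[OF ne, of "c + e"] by (auto simp: c_def)
    then have "0 \<le> Y + d *\<^sub>R 1" by (simp add: C_def)
    also have "\<dots> \<le> Y + (c + e) *\<^sub>R 1"
      using op_scaleR_one_mono[of d "c + e"] d by simp
    finally show "0 \<le> Y + c *\<^sub>R 1 + e *\<^sub>R 1" by (simp add: scaleR_add_left add.assoc)
  qed
  have "c = 0"
  proof (rule ccontr)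
    assume "c \<noteq> 0"
    then have "0 < c" using \<open>0 \<le> c\<close> by simp
    then obtain a where a: "0 < a" "a *\<^sub>R 1 \<le> Y + c *\<^sub>R 1"
      using op_invertible_bounded_below[OF c inv] by blast
    \<comment> \<open>Capping at \<open>c\<close> keeps \<open>c - b\<close> nonnegative, so that it
      lies in \<open>C\<close> and undercuts the infimum.\<close>
    define b where "b = min a c"
    have "b *\<^sub>R 1 \<le> Y + c *\<^sub>R 1"
      by (rule order_trans[OF op_scaleR_one_mono a(2)]) (simp add: b_def)
    then have "0 \<le> Y + (c - b) *\<^sub>R 1" by (simp add: scaleR_diff_left algebra_simps)
    then have "c - b \<in> C" by (simp add: C_def b_def)
    then have "c \<le> c - b" unfolding c_def by (rule cInf_lower[OF _ bdd])
    then show False using a \<open>0 < c\<close> by (simp add: b_def)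
  qed
  with c show ?thesis by simp
qed

text \<open>Adding a positive constant to \<open>q\<close> removes every zero on the spectrum, so
  the positive shifts of \<open>op_poly q X\<close> are invertible.\<close>

lemma op_poly_nonneg:
  fixes X :: "'a::complex_hilbert bounded_op"
  assumes X: "op_selfadj X"
    and nonneg: "\<And>x. complex_of_real x \<in> op_spectrum X \<Longrightarrow> 0 \<le> poly q x"
  shows "0 \<le> op_poly q X"
proof (rule op_nonneg_if_shifts_invertible)
  show "op_selfadj (op_poly q X)" by (rule op_selfadj_poly[OF X])
  fix c :: real assume c: "0 < c"
  show "op_invertible (op_poly q X + c *\<^sub>R 1)"
  proof (cases "q + [:c:] = 0")
    case False
    have "op_invertible (op_poly (q + [:c:]) X)"
      by (rule op_poly_invertible[OF X False]) (use nonneg c in fastforce)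
    then show ?thesis by (simp add: op_poly_add op_poly_pCons op_poly_0)
  next
    \<comment> \<open>Now \<open>q\<close> is a negative constant, so the assumption on
      \<open>q\<close> leaves no real point in the spectrum. Every real shift of \<open>X\<close> is
      then invertible, which puts \<open>X\<close> above \<open>norm X + 1\<close>; hence
      \<open>1 \<le> 0\<close>, the space is trivial, and every operator is invertible.\<close>
    case True
    then have q: "q = - [:c:]" by (rule eq_neg_iff_add_eq_0[THEN iffD2])
    then have inv: "op_invertible (X - x *\<^sub>R 1)" for x
      using nonneg[of x] c by (auto simp: of_real_op_spectrum_iff)
    let ?s = "norm X + 1"
    have "0 \<le> X - ?s *\<^sub>R 1"
    proof (rule op_nonneg_if_shifts_invertible)
      show "op_selfadj (X - ?s *\<^sub>R 1)" by (intro op_selfadj_diff X op_selfadj_scaleR op_selfadj_one)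
      show "op_invertible (X - ?s *\<^sub>R 1 + c *\<^sub>R 1)" for c
        using inv[of "?s - c"] by (simp only: scaleR_diff_left diff_diff_eq2 add_diff_eq)
          (simp add: add_diff_eq diff_add_eq)
    qed
    then have "?s *\<^sub>R 1 \<le> X" by simp
    then have "?s *\<^sub>R 1 \<le> norm X *\<^sub>R (1 :: 'a bounded_op)"
      using op_selfadj_le_norm[OF X] by (rule order_trans)
    then have "1 \<le> (0 :: 'a bounded_op)" by (simp add: scaleR_add_left)
    then have "1 = (0 :: 'a bounded_op)" using op_nonneg_one by (rule order_antisym)
    then have Y: "Y = 0" for Y :: "'a bounded_op" by (metis mult_1_left mult_zero_left)
    show ?thesis
      unfolding op_invertible_def by (rule exI[of _ 0]) (metis Y)
  qed
qed

section \<open>Continuous functional calculus\<close>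

text \<open>The polynomial \<open>d^2 - q^2\<close> is nonnegative on the spectrum, and the form of
  the square of a self-adjoint operator is a squared norm. The sign of \<open>d\<close> is a
  separate assumption because the spectrum is empty on the trivial space.\<close>

lemma norm_op_poly_le:
  fixes X :: "'a::complex_hilbert bounded_op"
  assumes X: "op_selfadj X" and d: "0 \<le> d"
    and le: "\<And>x. complex_of_real x \<in> op_spectrum X \<Longrightarrow> \<bar>poly q x\<bar> \<le> d"
  shows "norm (op_poly q X) \<le> d"
proof (rule norm_bounded_op_leI[OF d])
  fix x
  have "0 \<le> op_poly ([:d\<^sup>2:] - q * q) X"
  proof (rule op_poly_nonneg[OF X])
    fix x assume "complex_of_real x \<in> op_spectrum X"
    from power_mono[OF le[OF this], of 2] show "0 \<le> poly ([:d\<^sup>2:] - q * q) x"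
      by (simp add: power2_eq_square abs_mult_self_eq)
  qed
  then have "op_poly q X * op_poly q X \<le> d\<^sup>2 *\<^sub>R 1"
    by (simp add: op_poly_diff op_poly_mult op_poly_pCons op_poly_0)
  then have "op_qform (op_poly q X * op_poly q X) x \<le> op_qform (d\<^sup>2 *\<^sub>R 1) x"
    by (simp add: le_bounded_op_iff)
  then have "(norm (op_apply (op_poly q X) x))\<^sup>2 \<le> (d * norm x)\<^sup>2"
    by (simp add: op_qform_square[OF op_selfadj_poly[OF X]] op_qform_simps power_mult_distrib)
  then show "norm (op_apply (op_poly q X) x) \<le> d * norm x"
    by (rule power2_le_imp_le) (use d in simp)
qed

lemma Weierstrass_real_poly:
  fixes f :: "real \<Rightarrow> real"
  assumes "compact S" "continuous_on S f"
  shows "\<exists>p. uniform_limit S (\<lambda>n. poly (p n)) f sequentially"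
proof -
  have "\<exists>p. \<forall>x\<in>S. \<bar>f x - poly p x\<bar> < e" if e: "0 < e" for e
  proof -
    obtain g where "real_polynomial_function g" and g: "\<And>x. x \<in> S \<Longrightarrow> \<bar>f x - g x\<bar> < e"
      using Stone_Weierstrass_real_polynomial_function[OF assms e] by blast
    then obtain c n where "g = (\<lambda>x. \<Sum>i\<le>(n::nat). c i * x ^ i)"
      using real_polynomial_function_imp_sum by blast
    then have "g = poly (\<Sum>i\<le>n. monom (c i) i)"
      by (simp add: poly_sum poly_monom fun_eq_iff)
    with g show ?thesis by blast
  qed
  then have "\<forall>n. \<exists>p. \<forall>x\<in>S. \<bar>f x - poly p x\<bar> < inverse (real (Suc n))" by simp
  then obtain p where p: "\<And>n x. x \<in> S \<Longrightarrow> \<bar>f x - poly (p n) x\<bar> < inverse (real (Suc n))"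
    by metis
  have "uniform_limit S (\<lambda>n. poly (p n)) f sequentially"
  proof (rule uniform_limitI)
    fix e :: real assume "0 < e"
    then have "\<forall>\<^sub>F n in sequentially. inverse (real (Suc n)) < e"
      by (rule order_tendstoD(2)[OF LIMSEQ_inverse_real_of_nat])
    then show "\<forall>\<^sub>F n in sequentially. \<forall>x\<in>S. dist (poly (p n) x) (f x) < e"
    proof eventually_elim
      case (elim n)
      then show ?case
        using p[of _ n] by (auto simp: dist_real_def abs_minus_commute intro: less_trans)
    qed
  qed
  then show ?thesis by blast
qed

text \<open>With \<open>q = p\<close> this is the Cauchy property; with two sequences it says that
  the limit does not depend on the approximation.\<close>

lemma op_poly_close:
  fixes X :: "'a::complex_hilbert bounded_op"
  assumes X: "op_selfadj X" and S: "S = {x. complex_of_real x \<in> op_spectrum X}"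
    and p: "uniform_limit S (\<lambda>n. poly (p n)) f sequentially"
    and q: "uniform_limit S (\<lambda>n. poly (q n)) f sequentially" and e: "0 < e"
  shows "\<exists>N. \<forall>m\<ge>N. \<forall>n\<ge>N. norm (op_poly (p m) X - op_poly (q n) X) \<le> e"
proof -
  have "0 < e / 2" using e by simp
  from eventually_conj[OF uniform_limitD[OF p this] uniform_limitD[OF q this]]
  obtain N where N: "\<And>n x. n \<ge> N \<Longrightarrow> x \<in> S \<Longrightarrow>
      dist (poly (p n) x) (f x) < e / 2 \<and> dist (poly (q n) x) (f x) < e / 2"
    unfolding eventually_sequentially by blast
  have "norm (op_poly (p m - q n) X) \<le> e" if "m \<ge> N" "n \<ge> N" for m n
  proof (rule norm_op_poly_le[OF X])
    fix x assume "complex_of_real x \<in> op_spectrum X"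
    then have "x \<in> S" by (simp add: S)
    with N[of m x] N[of n x] that have "\<bar>poly (p m) x - f x\<bar> < e / 2" "\<bar>poly (q n) x - f x\<bar> < e / 2"
      by (simp_all add: dist_real_def)
    then show "\<bar>poly (p m - q n) x\<bar> \<le> e" unfolding poly_diff by arith
  qed (use e in simp)
  then show ?thesis by (metis op_poly_diff)
qed

text \<open>The order bounds enclose the spectrum in a compact interval, on which Weierstrass
  approximation applies directly and restricts to the spectrum.\<close>

locale op_interval =
  fixes X :: "'a::complex_hilbert bounded_op" and a b :: real
  assumes lower: "a *\<^sub>R 1 \<le> X" and upper: "X \<le> b *\<^sub>R 1"
begin

lemma selfadj: "op_selfadj X"
  using op_selfadj_add[of "X - a *\<^sub>R 1" "a *\<^sub>R 1"] lower
  by (simp add: le_bounded_op_iff op_selfadj_scaleR op_selfadj_one)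

text \<open>Shows that the description in \<open>op_cfc\<close> denotes. One approximation on
  \<open>{a..b}\<close> produces the limit \<open>T\<close>, and any sequence converging on the
  spectrum alone shares it.\<close>

lemma cfc_tendsto:
  assumes f: "continuous_on {a..b} f"
    and p: "uniform_limit {a..b} (\<lambda>n. poly (p n)) f sequentially"
  shows "(\<lambda>n. op_poly (p n) X) \<longlonglongrightarrow> op_cfc f X"
proof -
  define S where "S = {x. complex_of_real x \<in> op_spectrum X}"
  have sub: "S \<subseteq> {a..b}"
    using op_spectrum_bounds[OF lower upper] by (auto simp: S_def)
  then have pS: "uniform_limit S (\<lambda>n. poly (p n)) f sequentially"
    by (rule uniform_limit_on_subset[OF p])
  have "Cauchy (\<lambda>n. op_poly (p n) X)"
  proof (rule metric_CauchyI)
    fix e :: real assume "0 < e"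
    with op_poly_close[OF selfadj S_def pS pS, of "e / 2"]
    show "\<exists>M. \<forall>m\<ge>M. \<forall>n\<ge>M. dist (op_poly (p m) X) (op_poly (p n) X) < e"
      unfolding dist_norm by (metis half_gt_zero field_sum_of_halves less_add_same_cancel1 order_le_less_trans)
  qed
  then obtain T where T: "(\<lambda>n. op_poly (p n) X) \<longlonglongrightarrow> T"
    using Cauchy_convergent convergent_def by blast
  have lim: "(\<lambda>n. op_poly (q n) X) \<longlonglongrightarrow> T"
    if q: "uniform_limit S (\<lambda>n. poly (q n)) f sequentially" for q
  proof -
    have "(\<lambda>n. op_poly (q n) X - op_poly (p n) X) \<longlonglongrightarrow> 0"
    proof (rule metric_LIMSEQ_I)
      fix e :: real assume "0 < e"
      with op_poly_close[OF selfadj S_def q pS, of "e / 2"]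
      show "\<exists>N. \<forall>n\<ge>N. dist (op_poly (q n) X - op_poly (p n) X) 0 < e"
        unfolding dist_norm diff_zero
        by (metis half_gt_zero field_sum_of_halves less_add_same_cancel1 order_le_less_trans)
    qed
    from tendsto_add[OF this T] show ?thesis by simp
  qed
  have "op_cfc f X = T"
    unfolding op_cfc_def S_def[symmetric]
  proof (rule the_equality)
    show "\<forall>p. uniform_limit S (\<lambda>n. poly (p n)) f sequentially \<longrightarrow> (\<lambda>n. op_poly (p n) X) \<longlonglongrightarrow> T"
      using lim by blast
  next
    fix T' assume "\<forall>p. uniform_limit S (\<lambda>n. poly (p n)) f sequentially \<longrightarrow> (\<lambda>n. op_poly (p n) X) \<longlonglongrightarrow> T'"
    with pS have "(\<lambda>n. op_poly (p n) X) \<longlonglongrightarrow> T'" by blast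
    then show "T' = T" using T by (rule LIMSEQ_unique)
  qed
  with T show ?thesis by simp
qed

lemma cfc_eqI:
  assumes "continuous_on {a..b} f" "uniform_limit {a..b} (\<lambda>n. poly (p n)) f sequentially"
    "(\<lambda>n. op_poly (p n) X) \<longlonglongrightarrow> T"
  shows "op_cfc f X = T"
  using cfc_tendsto[OF assms(1,2)] assms(3) by (rule LIMSEQ_unique)

lemma cfc_approx:
  assumes "continuous_on {a..b} f"
  obtains p where "uniform_limit {a..b} (\<lambda>n. poly (p n)) f sequentially"
    "(\<lambda>n. op_poly (p n) X) \<longlonglongrightarrow> op_cfc f X"
  using Weierstrass_real_poly[OF compact_Icc assms] cfc_tendsto[OF assms] by blast

lemma cfc_poly: "op_cfc (poly p) X = op_poly p X"
  by (rule cfc_eqI[of _ "\<lambda>_. p"]) (auto intro!: continuous_intros uniform_limit_const)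

lemma cfc_const: "op_cfc (\<lambda>_. c) X = c *\<^sub>R 1"
proof -
  have "poly [:c:] = (\<lambda>_. c)" by auto
  with cfc_poly[of "[:c:]"] show ?thesis by (simp add: op_poly_pCons op_poly_0)
qed

lemma cfc_id: "op_cfc (\<lambda>x. x) X = X"
proof -
  have "poly [:0, 1:] = (\<lambda>x. x :: real)" by auto
  with cfc_poly[of "[:0, 1:]"] show ?thesis by (simp add: op_poly_pCons op_poly_0)
qed

lemma cfc_cong:
  assumes f: "continuous_on {a..b} f" and fg: "\<And>x. x \<in> {a..b} \<Longrightarrow> f x = g x"
  shows "op_cfc f X = op_cfc g X"
proof -
  obtain p where p: "uniform_limit {a..b} (\<lambda>n. poly (p n)) f sequentially"
    and lim: "(\<lambda>n. op_poly (p n) X) \<longlonglongrightarrow> op_cfc f X"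
    using cfc_approx[OF f] .
  have "continuous_on {a..b} g" using f continuous_on_cong[of "{a..b}" "{a..b}" f g] fg by simp
  moreover have "uniform_limit {a..b} (\<lambda>n. poly (p n)) g sequentially"
    using p uniform_limit_cong'[of "{a..b}" "\<lambda>n. poly (p n)" "\<lambda>n. poly (p n)" f g] fg by simp
  ultimately have "op_cfc g X = op_cfc f X" using lim by (rule cfc_eqI)
  then show ?thesis by simp
qed

lemma cfc_add:
  assumes f: "continuous_on {a..b} f" and g: "continuous_on {a..b} g"
  shows "op_cfc (\<lambda>x. f x + g x) X = op_cfc f X + op_cfc g X"
proof -
  obtain p where p: "uniform_limit {a..b} (\<lambda>n. poly (p n)) f sequentially"
    and pl: "(\<lambda>n. op_poly (p n) X) \<longlonglongrightarrow> op_cfc f X" using cfc_approx[OF f] .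
  obtain q where q: "uniform_limit {a..b} (\<lambda>n. poly (q n)) g sequentially"
    and ql: "(\<lambda>n. op_poly (q n) X) \<longlonglongrightarrow> op_cfc g X" using cfc_approx[OF g] .
  show ?thesis
  proof (rule cfc_eqI)
    show "uniform_limit {a..b} (\<lambda>n. poly (p n + q n)) (\<lambda>x. f x + g x) sequentially"
      unfolding poly_add by (rule uniform_limit_add[OF p q])
    show "(\<lambda>n. op_poly (p n + q n) X) \<longlonglongrightarrow> op_cfc f X + op_cfc g X"
      unfolding op_poly_add by (rule tendsto_add[OF pl ql])
  qed (intro continuous_intros f g)
qed

lemma cfc_mult:
  assumes f: "continuous_on {a..b} f" and g: "continuous_on {a..b} g"
  shows "op_cfc (\<lambda>x. f x * g x) X = op_cfc f X * op_cfc g X"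
proof -
  obtain p where p: "uniform_limit {a..b} (\<lambda>n. poly (p n)) f sequentially"
    and pl: "(\<lambda>n. op_poly (p n) X) \<longlonglongrightarrow> op_cfc f X" using cfc_approx[OF f] .
  obtain q where q: "uniform_limit {a..b} (\<lambda>n. poly (q n)) g sequentially"
    and ql: "(\<lambda>n. op_poly (q n) X) \<longlonglongrightarrow> op_cfc g X" using cfc_approx[OF g] .
  show ?thesis
  proof (rule cfc_eqI)
    show "uniform_limit {a..b} (\<lambda>n. poly (p n * q n)) (\<lambda>x. f x * g x) sequentially"
      unfolding poly_mult
      by (rule uniform_lim_mult[OF p q])
        (intro compact_imp_bounded compact_continuous_image compact_Icc f g)+
    show "(\<lambda>n. op_poly (p n * q n) X) \<longlonglongrightarrow> op_cfc f X * op_cfc g X"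
      unfolding op_poly_mult by (rule tendsto_mult[OF pl ql])
  qed (intro continuous_intros f g)
qed

lemma cfc_cmult:
  assumes "continuous_on {a..b} f"
  shows "op_cfc (\<lambda>x. c * f x) X = c *\<^sub>R op_cfc f X"
  using cfc_mult[of "\<lambda>_. c" f] assms by (simp add: cfc_const)

lemma cfc_diff:
  assumes "continuous_on {a..b} f" "continuous_on {a..b} g"
  shows "op_cfc (\<lambda>x. f x - g x) X = op_cfc f X - op_cfc g X"
  using cfc_add[of f "\<lambda>x. -1 * g x"] cfc_cmult[of g "-1"] assms
  by (simp add: continuous_on_minus)

text \<open>Approximating polynomials may dip below \<open>0\<close>, but eventually by less than
  \<open>e\<close>; hence the shift by \<open>e\<close>.\<close>

lemma cfc_nonneg:
  assumes f: "continuous_on {a..b} f" and nonneg: "\<And>x. x \<in> {a..b} \<Longrightarrow> 0 \<le> f x"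
  shows "0 \<le> op_cfc f X"
proof (rule op_nonneg_epsilon)
  fix e :: real assume e: "0 < e"
  obtain p where p: "uniform_limit {a..b} (\<lambda>n. poly (p n)) f sequentially"
    and pl: "(\<lambda>n. op_poly (p n) X) \<longlonglongrightarrow> op_cfc f X" using cfc_approx[OF f] .
  show "0 \<le> op_cfc f X + e *\<^sub>R 1"
  proof (rule op_nonneg_tendsto)
    show "(\<lambda>n. op_poly (p n) X + e *\<^sub>R 1) \<longlonglongrightarrow> op_cfc f X + e *\<^sub>R 1"
      by (intro tendsto_intros pl)
    show "\<forall>\<^sub>F n in sequentially. 0 \<le> op_poly (p n) X + e *\<^sub>R 1"
      using uniform_limitD[OF p e]
    proof eventually_elim
      case (elim n)
      have "0 \<le> op_poly (p n + [:e:]) X"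
      proof (rule op_poly_nonneg[OF selfadj])
        fix x assume "complex_of_real x \<in> op_spectrum X"
        then have "x \<in> {a..b}" by (rule op_spectrum_bounds[OF lower upper])
        with elim nonneg[of x] show "0 \<le> poly (p n + [:e:]) x"
          by (fastforce simp: dist_real_def abs_less_iff)
      qed
      then show ?case by (simp add: op_poly_add op_poly_pCons op_poly_0)
    qed
  qed simp
qed

lemma cfc_mono:
  assumes "continuous_on {a..b} f" "continuous_on {a..b} g" "\<And>x. x \<in> {a..b} \<Longrightarrow> f x \<le> g x"
  shows "op_cfc f X \<le> op_cfc g X"
  using cfc_nonneg[of "\<lambda>x. g x - f x"] assms by (simp add: cfc_diff continuous_on_diff)

text \<open>Adding a bound \<open>c\<close> for \<open>\<bar>f x\<bar>\<close> makes the function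
  nonnegative, and nonnegative operators are self-adjoint.\<close>

lemma cfc_selfadj:
  assumes f: "continuous_on {a..b} f"
  shows "op_selfadj (op_cfc f X)"
proof -
  have "bounded (f ` {a..b})"
    by (intro compact_imp_bounded compact_continuous_image compact_Icc f)
  then obtain c where c': "\<And>x. x \<in> {a..b} \<Longrightarrow> \<bar>f x\<bar> \<le> c"
    unfolding bounded_iff by fastforce
  have c: "0 \<le> f x - - c" if "x \<in> {a..b}" for x
    using c'[OF that] by arith
  have "0 \<le> op_cfc (\<lambda>x. f x - - c) X"
    by (intro cfc_nonneg continuous_intros f c)
  then have "op_selfadj (op_cfc f X - (- c) *\<^sub>R 1)"
    using f by (simp only: cfc_diff continuous_on_const cfc_const op_selfadjI)
  from op_selfadj_add[OF this op_selfadj_scaleR[OF op_selfadj_one, of "- c"]] show ?thesis by simp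
qed

lemma norm_cfc_le:
  assumes f: "continuous_on {a..b} f" and d: "0 \<le> d" "\<And>x. x \<in> {a..b} \<Longrightarrow> \<bar>f x\<bar> \<le> d"
  shows "norm (op_cfc f X) \<le> d"
proof (rule norm_bounded_op_leI[OF d(1)])
  fix x
  have "op_cfc (\<lambda>x. f x * f x) X \<le> op_cfc (\<lambda>_. d\<^sup>2) X"
    using power_mono[OF d(2), of _ 2]
    by (intro cfc_mono continuous_intros f) (simp add: power2_eq_square)
  then have "op_cfc f X * op_cfc f X \<le> d\<^sup>2 *\<^sub>R 1"
    by (simp add: cfc_mult[OF f f] cfc_const)
  then have "op_qform (op_cfc f X * op_cfc f X) x \<le> op_qform (d\<^sup>2 *\<^sub>R 1) x"
    by (simp add: le_bounded_op_iff)
  then have "(norm (op_apply (op_cfc f X) x))\<^sup>2 \<le> (d * norm x)\<^sup>2"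
    by (simp add: op_qform_square[OF cfc_selfadj[OF f]] op_qform_simps power_mult_distrib)
  then show "norm (op_apply (op_cfc f X) x) \<le> d * norm x"
    by (rule power2_le_imp_le) (use d in simp)
qed

lemma cfc_uniform_limit:
  assumes f: "\<And>n. continuous_on {a..b} (f n)" and g: "continuous_on {a..b} g"
    and lim: "uniform_limit {a..b} f g sequentially"
  shows "(\<lambda>n. op_cfc (f n) X) \<longlonglongrightarrow> op_cfc g X"
proof (rule metric_LIMSEQ_I)
  fix e :: real assume e: "0 < e"
  have "\<forall>\<^sub>F n in sequentially. \<forall>x\<in>{a..b}. dist (f n x) (g x) < e / 2"
    by (rule uniform_limitD[OF lim]) (use e in simp)
  then have "\<forall>\<^sub>F n in sequentially. dist (op_cfc (f n) X) (op_cfc g X) < e"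
  proof eventually_elim
    case (elim n)
    have "norm (op_cfc (\<lambda>x. f n x - g x) X) \<le> e / 2"
      by (rule norm_cfc_le) (use elim e f g in \<open>auto simp: dist_real_def intro!: continuous_intros less_imp_le\<close>)
    then show ?case using e by (simp add: cfc_diff f g dist_norm)
  qed
  then show "\<exists>N. \<forall>n\<ge>N. dist (op_cfc (f n) X) (op_cfc g X) < e"
    by (simp add: eventually_sequentially)
qed

end

section \<open>Operator means\<close>

text \<open>Positive invertible operators, encoded by a scalar lower bound: it passes to larger
  operators at once and keeps the spectrum away from \<open>0\<close>.\<close>

definition op_pos :: "'a::complex_hilbert bounded_op \<Rightarrow> bool"
  where "op_pos A \<longleftrightarrow> (\<exists>a>0. a *\<^sub>R 1 \<le> A)"

lemma op_pos_nonneg: "op_pos A \<Longrightarrow> 0 \<le> A"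
  unfolding op_pos_def by (meson less_imp_le op_nonneg_one order_trans scaleR_nonneg_nonneg)

lemma op_pos_iff: "op_pos A \<longleftrightarrow> 0 \<le> A \<and> op_invertible A"
  using op_pos_nonneg op_invertible_bounded_below op_invertibleI_bounded_below
  unfolding op_pos_def by blast

lemma op_pos_mono: "op_pos A \<Longrightarrow> A \<le> B \<Longrightarrow> op_pos B"
  unfolding op_pos_def by (meson order_trans)

lemma op_pos_add_scaleR: "0 \<le> A \<Longrightarrow> 0 < e \<Longrightarrow> op_pos (A + e *\<^sub>R 1)"
  unfolding op_pos_def by (intro exI[of _ e]) simp

lemma op_pos_interval:
  assumes "op_pos A"
  obtains a b where "0 < a" "op_interval A a b"
proof -
  obtain a where a: "0 < a" "a *\<^sub>R 1 \<le> A" using assms by (auto simp: op_pos_def)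
  then have "op_interval A a (norm A)"
    by unfold_locales (simp_all add: op_selfadj_le_norm op_selfadjI op_pos_nonneg assms)
  with a that show ?thesis by blast
qed

lemma continuous_on_powr_Icc: "0 < a \<Longrightarrow> continuous_on {a..b} (\<lambda>x. x powr s :: real)"
  by (intro continuous_intros) auto

lemma op_powr_selfadj:
  assumes "op_pos A"
  shows "op_selfadj (op_powr A s)"
proof -
  obtain a b where a: "0 < a" and I: "op_interval A a b" using op_pos_interval[OF assms] .
  show ?thesis unfolding op_powr_def
    by (rule op_interval.cfc_selfadj[OF I continuous_on_powr_Icc[OF a]])
qed

lemma op_powr_add:
  assumes "op_pos A"
  shows "op_powr A s * op_powr A t = op_powr A (s + t)"
proof -
  obtain a b where a: "0 < a" and I: "op_interval A a b" using op_pos_interval[OF assms] .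
  show ?thesis unfolding op_powr_def powr_add
    by (rule op_interval.cfc_mult[OF I continuous_on_powr_Icc[OF a] continuous_on_powr_Icc[OF a], symmetric])
qed

lemma op_powr_0:
  assumes "op_pos A"
  shows "op_powr A 0 = 1"
proof -
  obtain a b where a: "0 < a" and I: "op_interval A a b" using op_pos_interval[OF assms] .
  \<comment> \<open>The interval starts at a positive \<open>a\<close>, so the default
    \<open>0 powr 0 = 0\<close> is never met.\<close>
  have "op_cfc (\<lambda>x. x powr 0) A = op_cfc (\<lambda>_. 1) A"
    by (rule op_interval.cfc_cong[OF I continuous_on_powr_Icc[OF a]]) (use a in auto)
  then show ?thesis by (simp only: op_powr_def op_interval.cfc_const[OF I] scaleR_one)
qed

lemma op_powr_1:
  assumes "op_pos A"
  shows "op_powr A 1 = A"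
proof -
  obtain a b where a: "0 < a" and I: "op_interval A a b" using op_pos_interval[OF assms] .
  have "op_cfc (\<lambda>x. x powr 1) A = op_cfc (\<lambda>x. x) A"
    by (rule op_interval.cfc_cong[OF I continuous_on_powr_Icc[OF a]]) (use a in auto)
  then show ?thesis by (simp only: op_powr_def op_interval.cfc_id[OF I])
qed

lemma op_selfadj_inverse:
  assumes "op_selfadj X" "X * Y = 1"
  shows "op_selfadj Y"
  unfolding op_selfadj_def
proof (intro allI)
  fix x y
  have *: "op_apply X (op_apply Y z) = z" for z
    by (metis assms(2) one_bounded_op.rep_eq times_bounded_op.rep_eq)
  have "cinner (op_apply Y x) y = cinner (op_apply Y x) (op_apply X (op_apply Y y))" by (simp only: *)
  also have "\<dots> = cinner (op_apply X (op_apply Y x)) (op_apply Y y)"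
    using assms(1) by (simp add: op_selfadj_def)
  finally show "cinner (op_apply Y x) y = cinner x (op_apply Y y)" by (simp only: *)
qed

text \<open>The form of \<open>X\<close> is nonnegative at \<open>X\<^sup>-\<^sup>1 x - Y\<^sup>-\<^sup>1 x\<close>.\<close>
lemma op_inverse_antimono:
  fixes X Y :: "'a::complex_hilbert bounded_op"
  assumes X: "0 \<le> X" "X \<le> Y" and inv: "X * X' = 1" "Y * Y' = 1"
  shows "Y' \<le> X'"
proof -
  have sX: "op_selfadj X" and sY: "op_selfadj Y"
    using X op_selfadjI order_trans by blast+
  have sX': "op_selfadj X'" and sY': "op_selfadj Y'"
    using op_selfadj_inverse sX sY inv by blast+
  have "op_qform Y' x \<le> op_qform X' x" for x
  proof -
    let ?u = "op_apply X' x" and ?v = "op_apply Y' x"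
    have XX: "op_apply X ?u = x" and YY: "op_apply Y ?v = x"
      by (metis inv one_bounded_op.rep_eq times_bounded_op.rep_eq)+
    have "0 \<le> op_qform X (?u - ?v)" using X(1) by (simp add: op_nonneg_iff)
    also have "op_apply X (?u - ?v) = x - op_apply X ?v"
      using linear_diff[OF op_apply_linear, of X ?u ?v] XX by simp
    then have "op_qform X (?u - ?v) = Re (cinner x ?u) - Re (cinner x ?v)
        - (Re (cinner (op_apply X ?v) ?u) - op_qform X ?v)"
      by (simp add: op_qform_def cinner_diff_left cinner_diff_right)
    also have "cinner (op_apply X ?v) ?u = cinner ?v x"
      using sX XX by (simp add: op_selfadj_def)
    finally have "0 \<le> op_qform X' x - 2 * op_qform Y' x + op_qform X ?v"
      by (simp add: op_qform_def Re_cinner_commute[of x])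
    moreover have "op_qform X ?v \<le> op_qform Y ?v" using X by (simp add: le_bounded_op_iff)
    moreover have "op_qform Y ?v = op_qform Y' x"
      using YY by (simp add: op_qform_def Re_cinner_commute[of x])
    ultimately show ?thesis by simp
  qed
  then show ?thesis
    using sX' sY' by (simp add: le_bounded_op_iff op_selfadj_diff)
qed

text \<open>The operator perspective of \<open>f\<close>: the constant \<open>1\<close> returns
  \<open>A\<close> and the identity returns \<open>B\<close>.\<close>

definition op_mean ::
  "(real \<Rightarrow> real) \<Rightarrow> 'a::complex_hilbert bounded_op \<Rightarrow> 'a bounded_op \<Rightarrow> 'a bounded_op"
  where "op_mean f A B =
    op_powr A (1/2) * op_cfc f (op_powr A (-1/2) * B * op_powr A (-1/2)) * op_powr A (1/2)"

text \<open>With the outer factors inverted, this yields the inverse of \<open>op_mean f A B\<close>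
  when applied to the reciprocal of \<open>f\<close>; parallel sums then become ordinary
  sums.\<close>

definition op_mean_inv ::
  "(real \<Rightarrow> real) \<Rightarrow> 'a::complex_hilbert bounded_op \<Rightarrow> 'a bounded_op \<Rightarrow> 'a bounded_op"
  where "op_mean_inv f A B =
    op_powr A (-1/2) * op_cfc f (op_powr A (-1/2) * B * op_powr A (-1/2)) * op_powr A (-1/2)"

lemma geo_mean_inv_eq_op_mean: "geo_mean_inv A u B = op_mean (\<lambda>x. x powr u) A B"
  by (simp add: geo_mean_inv_def op_mean_def op_powr_def)

locale op_pair =
  fixes A B :: "'a::complex_hilbert bounded_op"
  assumes posA: "op_pos A" and posB: "op_pos B"
begin

definition "S = op_powr A (1/2)"
definition "T = op_powr A (-1/2)"
definition "X = T * B * T"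

lemma mean_eq: "op_mean f A B = S * op_cfc f X * S"
  by (simp only: op_mean_def S_def T_def X_def)

lemma mean_inv_eq: "op_mean_inv f A B = T * op_cfc f X * T"
  by (simp only: op_mean_inv_def T_def X_def)

lemma ST: "S * S = A" "S * T = 1" "T * S = 1"
  unfolding S_def T_def by (simp_all add: op_powr_add[OF posA] op_powr_0[OF posA] op_powr_1[OF posA])

lemma mult_ST: "S * (T * Z) = Z" "T * (S * Z) = Z"
  by (metis ST mult.assoc mult_1_left)+

lemma selfadj_ST: "op_selfadj S" "op_selfadj T"
  unfolding S_def T_def by (rule op_powr_selfadj[OF posA])+

lemma pos_X: "op_pos X"
proof -
  have "op_invertible T" using ST unfolding op_invertible_def by blast
  with posB show ?thesis
    unfolding op_pos_iff X_def by (intro conjI op_conj_nonneg op_invertible_mult selfadj_ST) auto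
qed

lemma continuous_Icc: "continuous_on {0<..} f \<Longrightarrow> 0 < a \<Longrightarrow> continuous_on {a..b} (f :: real \<Rightarrow> real)"
  by (erule continuous_on_subset) auto

lemma mean_const: "op_mean (\<lambda>_. c) A B = c *\<^sub>R A"
proof -
  obtain a b where a: "0 < a" and I: "op_interval X a b" using op_pos_interval[OF pos_X] .
  show ?thesis by (simp add: mean_eq op_interval.cfc_const[OF I] ST)
qed

lemma mean_id: "op_mean (\<lambda>x. x) A B = B"
proof -
  obtain a b where a: "0 < a" and I: "op_interval X a b" using op_pos_interval[OF pos_X] .
  show ?thesis
    unfolding mean_eq op_interval.cfc_id[OF I] by (simp add: X_def mult.assoc mult_ST ST)
qed

lemma mean_add:
  assumes "continuous_on {0<..} f" "continuous_on {0<..} g"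
  shows "op_mean (\<lambda>x. f x + g x) A B = op_mean f A B + op_mean g A B"
proof -
  obtain a b where a: "0 < a" and I: "op_interval X a b" using op_pos_interval[OF pos_X] .
  show ?thesis
    using assms a by (simp add: mean_eq op_interval.cfc_add[OF I] continuous_Icc algebra_simps)
qed

lemma mean_inv_add:
  assumes "continuous_on {0<..} f" "continuous_on {0<..} g"
  shows "op_mean_inv (\<lambda>x. f x + g x) A B = op_mean_inv f A B + op_mean_inv g A B"
proof -
  obtain a b where a: "0 < a" and I: "op_interval X a b" using op_pos_interval[OF pos_X] .
  show ?thesis
    using assms a by (simp add: mean_inv_eq op_interval.cfc_add[OF I] continuous_Icc algebra_simps)
qed

lemma mean_cmult:
  assumes "continuous_on {0<..} f"
  shows "op_mean (\<lambda>x. c * f x) A B = c *\<^sub>R op_mean f A B"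
proof -
  obtain a b where a: "0 < a" and I: "op_interval X a b" using op_pos_interval[OF pos_X] .
  show ?thesis
    using assms a by (simp add: mean_eq op_interval.cfc_cmult[OF I] continuous_Icc)
qed

lemma mean_cong:
  assumes "continuous_on {0<..} f" "\<And>x. 0 < x \<Longrightarrow> f x = g x"
  shows "op_mean f A B = op_mean g A B"
proof -
  obtain a b where a: "0 < a" and I: "op_interval X a b" using op_pos_interval[OF pos_X] .
  have "op_cfc f X = op_cfc g X"
    by (rule op_interval.cfc_cong[OF I continuous_Icc[OF assms(1) a]]) (use a assms in auto)
  then show ?thesis by (simp only: mean_eq)
qed

lemma mean_nonneg:
  assumes "continuous_on {0<..} f" "\<And>x. 0 < x \<Longrightarrow> 0 \<le> f x"
  shows "0 \<le> op_mean f A B"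
proof -
  obtain a b where a: "0 < a" and I: "op_interval X a b" using op_pos_interval[OF pos_X] .
  have "0 \<le> op_cfc f X"
    by (rule op_interval.cfc_nonneg[OF I continuous_Icc[OF assms(1) a]]) (use a assms in auto)
  then show ?thesis unfolding mean_eq by (rule op_conj_nonneg[OF selfadj_ST(1)])
qed

lemma mean_inv_nonneg:
  assumes "continuous_on {0<..} f" "\<And>x. 0 < x \<Longrightarrow> 0 \<le> f x"
  shows "0 \<le> op_mean_inv f A B"
proof -
  obtain a b where a: "0 < a" and I: "op_interval X a b" using op_pos_interval[OF pos_X] .
  have "0 \<le> op_cfc f X"
    by (rule op_interval.cfc_nonneg[OF I continuous_Icc[OF assms(1) a]]) (use a assms in auto)
  then show ?thesis unfolding mean_inv_eq by (rule op_conj_nonneg[OF selfadj_ST(2)])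
qed

lemma mean_inverse:
  assumes f: "continuous_on {0<..} f" and fg: "\<And>x. 0 < x \<Longrightarrow> f x * g x = 1"
  shows "op_mean f A B * op_mean_inv g A B = 1" "op_mean_inv g A B * op_mean f A B = 1"
proof -
  obtain a b where a: "0 < a" and I: "op_interval X a b" using op_pos_interval[OF pos_X] .
  have "continuous_on {0<..} (\<lambda>x. 1 / f x)"
    by (intro continuous_intros f) (metis fg greaterThan_iff mult_zero_left zero_neq_one)
  then have "continuous_on {0<..} g"
    by (rule continuous_on_cong[THEN iffD1, rotated 2])
      (use fg in \<open>auto simp: field_simps\<close>, metis fg mult.commute mult_zero_left nonzero_divide_eq_eq zero_neq_one)
  note cont = continuous_Icc[OF f a, of b] continuous_Icc[OF this a, of b]
  have "op_cfc (\<lambda>x. f x * g x) X = op_cfc (\<lambda>_. 1) X"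
    by (rule op_interval.cfc_cong[OF I continuous_on_mult[OF cont]]) (use a fg in auto)
  then have 1: "op_cfc f X * op_cfc g X = 1"
    by (simp only: op_interval.cfc_mult[OF I cont] op_interval.cfc_const[OF I] scaleR_one)
  have "op_cfc (\<lambda>x. g x * f x) X = op_cfc (\<lambda>_. 1) X"
    by (rule op_interval.cfc_cong[OF I continuous_on_mult[OF cont(2,1)]])
      (use a fg in \<open>auto simp: mult.commute\<close>)
  then have 2: "op_cfc g X * op_cfc f X = 1"
    by (simp only: op_interval.cfc_mult[OF I cont(2,1)] op_interval.cfc_const[OF I] scaleR_one)
  have "S * F * S * (T * G * T) = 1" "T * G * T * (S * F * S) = 1"
    if "F * G = 1" "G * F = 1" for F G
  proof -
    have "F * (G * Z) = Z" "G * (F * Z) = Z" for Z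
      using that by (simp_all flip: mult.assoc)
    then show "S * F * S * (T * G * T) = 1" "T * G * T * (S * F * S) = 1"
      by (simp_all add: mult.assoc mult_ST ST)
  qed
  from this[OF 1 2] show "op_mean f A B * op_mean_inv g A B = 1" "op_mean_inv g A B * op_mean f A B = 1"
    unfolding mean_eq mean_inv_eq by auto
qed

lemma mean_uniform_limit:
  assumes f: "\<And>n. continuous_on {0<..} (f n)" and g: "continuous_on {0<..} g"
    and lim: "\<And>a b. 0 < a \<Longrightarrow> uniform_limit {a..b} f g sequentially"
  shows "(\<lambda>n. op_mean (f n) A B) \<longlonglongrightarrow> op_mean g A B"
proof -
  obtain a b where a: "0 < a" and I: "op_interval X a b" using op_pos_interval[OF pos_X] .
  show ?thesis
    unfolding mean_eq
    by (intro tendsto_intros op_interval.cfc_uniform_limit[OF I] continuous_Icc[OF _ a] f g lim a)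
qed

end

section \<open>Joint monotonicity\<close>

text \<open>The \<open>itself\<close> argument fixes the Hilbert space, which \<open>f\<close> does
  not determine. Positivity of \<open>f\<close> is carried along so that reciprocals and parallel
  sums are available.\<close>

definition mean_monotone :: "'a::complex_hilbert itself \<Rightarrow> (real \<Rightarrow> real) \<Rightarrow> bool"
  where "mean_monotone _ f \<longleftrightarrow> continuous_on {0<..} f \<and> (\<forall>x>0. 0 < f x) \<and>
    (\<forall>A A' B B' :: 'a bounded_op. op_pos A \<longrightarrow> op_pos B \<longrightarrow> A \<le> A' \<longrightarrow> B \<le> B' \<longrightarrow>
      op_mean f A B \<le> op_mean f A' B')"

lemma mean_monotoneI:
  assumes "continuous_on {0<..} f" "\<And>x. 0 < x \<Longrightarrow> 0 < f x"
    and "\<And>A A' B B' :: 'a::complex_hilbert bounded_op.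
      op_pair A B \<Longrightarrow> op_pair A' B' \<Longrightarrow> A \<le> A' \<Longrightarrow> B \<le> B' \<Longrightarrow> op_mean f A B \<le> op_mean f A' B'"
  shows "mean_monotone TYPE('a) f"
  using assms unfolding mean_monotone_def op_pair_def by (metis op_pos_mono)

lemma mean_monotoneD:
  assumes "mean_monotone TYPE('a::complex_hilbert) f"
  shows "continuous_on {0<..} f" "\<And>x. 0 < x \<Longrightarrow> 0 < f x"
    and "\<And>A A' B B' :: 'a bounded_op.
      op_pair A B \<Longrightarrow> A \<le> A' \<Longrightarrow> B \<le> B' \<Longrightarrow> op_mean f A B \<le> op_mean f A' B'"
  using assms by (auto simp: mean_monotone_def op_pair_def)

lemma mean_monotone_cong:
  assumes f: "mean_monotone TYPE('a::complex_hilbert) f" and fg: "\<And>x. 0 < x \<Longrightarrow> f x = g x"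
  shows "mean_monotone TYPE('a) g"
proof (rule mean_monotoneI)
  show "continuous_on {0<..} g"
    using mean_monotoneD(1)[OF f] continuous_on_cong[of "{0<..}" "{0<..}" f g] fg by simp
  fix A A' B B' :: "'a bounded_op"
  assume "op_pair A B" "op_pair A' B'" "A \<le> A'" "B \<le> B'"
  then show "op_mean g A B \<le> op_mean g A' B'"
    using mean_monotoneD(3)[OF f] op_pair.mean_cong[OF _ mean_monotoneD(1)[OF f] fg] by metis
qed (use mean_monotoneD(2)[OF f] fg in force)

lemma mean_monotone_one: "mean_monotone TYPE('a::complex_hilbert) (\<lambda>_. 1)"
  by (rule mean_monotoneI) (simp_all add: op_pair.mean_const)

lemma mean_monotone_id: "mean_monotone TYPE('a::complex_hilbert) (\<lambda>x. x)"
  by (rule mean_monotoneI) (simp_all add: op_pair.mean_id)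

lemma mean_monotone_add:
  assumes f: "mean_monotone TYPE('a::complex_hilbert) f" and g: "mean_monotone TYPE('a) g"
  shows "mean_monotone TYPE('a) (\<lambda>x. f x + g x)"
proof (rule mean_monotoneI)
  note fD = mean_monotoneD[OF f] and gD = mean_monotoneD[OF g]
  show "continuous_on {0<..} (\<lambda>x. f x + g x)" by (intro continuous_intros fD gD)
  show "0 < f x + g x" if "0 < x" for x using fD(2)[OF that] gD(2)[OF that] by simp
  fix A A' B B' :: "'a bounded_op"
  assume "op_pair A B" "op_pair A' B'" "A \<le> A'" "B \<le> B'"
  then show "op_mean (\<lambda>x. f x + g x) A B \<le> op_mean (\<lambda>x. f x + g x) A' B'"
    by (simp add: op_pair.mean_add fD(1) gD(1) add_mono fD(3) gD(3))
qed

lemma mean_monotone_cmult: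
  assumes f: "mean_monotone TYPE('a::complex_hilbert) f" and c: "0 < c"
  shows "mean_monotone TYPE('a) (\<lambda>x. c * f x)"
proof (rule mean_monotoneI)
  note fD = mean_monotoneD[OF f]
  show "continuous_on {0<..} (\<lambda>x. c * f x)" by (intro continuous_intros fD)
  show "0 < c * f x" if "0 < x" for x using fD(2)[OF that] c by simp
  fix A A' B B' :: "'a bounded_op"
  assume "op_pair A B" "op_pair A' B'" "A \<le> A'" "B \<le> B'"
  then show "op_mean (\<lambda>x. c * f x) A B \<le> op_mean (\<lambda>x. c * f x) A' B'"
    using c by (simp add: op_pair.mean_cmult fD(1) scaleR_left_mono fD(3))
qed

text \<open>The mean of \<open>f g / (f + g)\<close> is the parallel sum of the means of \<open>f\<close> and \<open>g\<close>; its inverse is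
  the sum of their inverses, so monotonicity follows by inverting twice.\<close>
lemma mean_monotone_parallel:
  assumes f: "mean_monotone TYPE('a::complex_hilbert) f" and g: "mean_monotone TYPE('a) g"
  shows "mean_monotone TYPE('a) (\<lambda>x. f x * g x / (f x + g x))"
proof (rule mean_monotoneI)
  note fD = mean_monotoneD[OF f] and gD = mean_monotoneD[OF g]
  let ?h = "\<lambda>x. f x * g x / (f x + g x)" and ?k = "\<lambda>x. 1 / f x + 1 / g x"
  have nz: "f x \<noteq> 0" "g x \<noteq> 0" "f x + g x \<noteq> 0" if "0 < x" for x
    using fD(2)[OF that] gD(2)[OF that] by auto
  have cont: "continuous_on {0<..} (\<lambda>x. 1 / f x)" "continuous_on {0<..} (\<lambda>x. 1 / g x)"
    using nz by (auto intro!: continuous_intros fD gD)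
  show hc: "continuous_on {0<..} ?h" using nz by (auto intro!: continuous_intros fD gD)
  show "0 < ?h x" if "0 < x" for x
    using fD(2)[OF that] gD(2)[OF that] by (simp add: add_pos_pos)
  have hk: "?h x * ?k x = 1" if "0 < x" for x
  proof -
    have "?k x = (f x + g x) / (f x * g x)" using nz[OF that] by (simp add: add_divide_distrib)
    then show ?thesis using nz[OF that] by simp
  qed
  have one: "f x * (1 / f x) = 1" "g x * (1 / g x) = 1" if "0 < x" for x
    using nz[OF that] by simp_all
  fix A A' B B' :: "'a bounded_op"
  assume P: "op_pair A B" and P': "op_pair A' B'" and le: "A \<le> A'" "B \<le> B'"
  have nonneg: "0 \<le> op_mean u A B" if "mean_monotone TYPE('a) u" for u
    using op_pair.mean_nonneg[OF P mean_monotoneD(1)[OF that]] mean_monotoneD(2)[OF that]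
    by (simp add: less_imp_le)
  have "op_mean_inv (\<lambda>x. 1 / f x) A' B' \<le> op_mean_inv (\<lambda>x. 1 / f x) A B"
    by (rule op_inverse_antimono[OF nonneg[OF f] fD(3)[OF P le]
          op_pair.mean_inverse(1)[OF P fD(1) one(1)] op_pair.mean_inverse(1)[OF P' fD(1) one(1)]])
  moreover have "op_mean_inv (\<lambda>x. 1 / g x) A' B' \<le> op_mean_inv (\<lambda>x. 1 / g x) A B"
    by (rule op_inverse_antimono[OF nonneg[OF g] gD(3)[OF P le]
          op_pair.mean_inverse(1)[OF P gD(1) one(2)] op_pair.mean_inverse(1)[OF P' gD(1) one(2)]])
  ultimately have "op_mean_inv ?k A' B' \<le> op_mean_inv ?k A B"
    by (simp add: op_pair.mean_inv_add[OF P cont] op_pair.mean_inv_add[OF P' cont] add_mono)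
  moreover have "0 \<le> op_mean_inv ?k A' B'"
  proof (rule op_pair.mean_inv_nonneg[OF P'])
    show "continuous_on {0<..} ?k" by (intro continuous_on_add cont)
    show "0 \<le> ?k x" if "0 < x" for x using fD(2)[OF that] gD(2)[OF that] by simp
  qed
  ultimately show "op_mean ?h A B \<le> op_mean ?h A' B'"
    using op_inverse_antimono op_pair.mean_inverse(2)[OF P hc hk] op_pair.mean_inverse(2)[OF P' hc hk]
    by blast
qed

lemma mean_monotone_uniform_limit:
  assumes f: "\<And>n. mean_monotone TYPE('a::complex_hilbert) (f n)"
    and g: "continuous_on {0<..} g" "\<And>x. 0 < x \<Longrightarrow> 0 < g x"
    and lim: "\<And>a b. 0 < a \<Longrightarrow> uniform_limit {a..b} f g sequentially"
  shows "mean_monotone TYPE('a) g"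
proof (rule mean_monotoneI[OF g])
  fix A A' B B' :: "'a bounded_op"
  assume P: "op_pair A B" and P': "op_pair A' B'" and le: "A \<le> A'" "B \<le> B'"
  have "0 \<le> op_mean g A' B' - op_mean g A B"
  proof (rule op_nonneg_tendsto)
    show "(\<lambda>n. op_mean (f n) A' B' - op_mean (f n) A B) \<longlonglongrightarrow> op_mean g A' B' - op_mean g A B"
      by (intro tendsto_diff op_pair.mean_uniform_limit P P' mean_monotoneD(1)[OF f] g lim)
    show "\<forall>\<^sub>F n in sequentially. 0 \<le> op_mean (f n) A' B' - op_mean (f n) A B"
      using mean_monotoneD(3)[OF f P le] by simp
  qed simp
  then show "op_mean g A B \<le> op_mean g A' B'" by simp
qed

text \<open>The pair consists of the arithmetic and the harmonic mean of the previous pair; the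
  latter is written as twice a parallel sum, to match \<open>mean_monotone_parallel\<close>.\<close>

primrec ah_iter :: "nat \<Rightarrow> real \<Rightarrow> real \<Rightarrow> real \<times> real" where
  "ah_iter 0 p q = (p, q)"
| "ah_iter (Suc n) p q = (let (a, h) = ah_iter n p q in ((a + h) / 2, 2 * (a * h / (a + h))))"

text \<open>The product is invariant, and the new gap is \<open>(a - h)^2 / (2 * (a + h))\<close>,
  at most half the old one since \<open>\<bar>a - h\<bar> \<le> a + h\<close>. Absolute values are
  needed because the initial pair may come in either order.\<close>

lemma ah_iter:
  assumes "0 < p" "0 < q"
  shows "0 < fst (ah_iter n p q) \<and> 0 < snd (ah_iter n p q) \<and>
    fst (ah_iter n p q) * snd (ah_iter n p q) = p * q \<and>
    \<bar>fst (ah_iter n p q) - snd (ah_iter n p q)\<bar> \<le> \<bar>p - q\<bar> / 2 ^ n"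
proof (induction n)
  case (Suc n)
  obtain a h where ah: "ah_iter n p q = (a, h)" by force
  with Suc have pos: "0 < a" "0 < h" "0 < a + h" and prod: "a * h = p * q"
    and le: "\<bar>a - h\<bar> \<le> \<bar>p - q\<bar> / 2 ^ n" by auto
  have eq: "(a + h) / 2 - 2 * (a * h / (a + h)) = \<bar>a - h\<bar> * (\<bar>a - h\<bar> / (a + h)) / 2"
    using pos by (simp add: field_simps flip: abs_mult power2_eq_square) (simp add: power2_eq_square algebra_simps)
  have "\<bar>a - h\<bar> / (a + h) \<le> 1" using pos by (simp add: abs_le_iff)
  then have "\<bar>a - h\<bar> * (\<bar>a - h\<bar> / (a + h)) \<le> \<bar>a - h\<bar> * 1" by (rule mult_left_mono) simp
  then have "\<bar>a - h\<bar> * (\<bar>a - h\<bar> / (a + h)) \<le> \<bar>a - h\<bar>" by (simp only: mult_1_right)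
  moreover have "0 \<le> \<bar>a - h\<bar> * (\<bar>a - h\<bar> / (a + h))" using pos by simp
  ultimately have w: "0 \<le> \<bar>a - h\<bar> * (\<bar>a - h\<bar> / (a + h))"
    "\<bar>a - h\<bar> * (\<bar>a - h\<bar> / (a + h)) \<le> \<bar>a - h\<bar>" by blast+
  have half: "\<bar>W / 2\<bar> \<le> c / 2" if "0 \<le> W" "W \<le> c" for W c :: real
    using that by simp
  have "\<bar>(a + h) / 2 - 2 * (a * h / (a + h))\<bar> \<le> \<bar>a - h\<bar> / 2"
    unfolding eq by (rule half[OF w])
  also have "\<dots> \<le> \<bar>p - q\<bar> / 2 ^ Suc n" using le by simp
  finally have "\<bar>(a + h) / 2 - 2 * (a * h / (a + h))\<bar> \<le> \<bar>p - q\<bar> / 2 ^ Suc n" .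
  moreover have "(a + h) / 2 * (2 * (a * h / (a + h))) = p * q" using pos prod by simp
  moreover have "0 < (a + h) / 2" "0 < 2 * (a * h / (a + h))" using pos by simp_all
  ultimately show ?case by (simp only: ah_iter.simps ah Let_def case_prod_conv fst_conv snd_conv simp_thms)
qed (use assms in simp)

text \<open>The root of the invariant product lies between the two components, so the gap bounds the
  error.\<close>

lemma ah_iter_close:
  assumes "0 < p" "0 < q"
  shows "\<bar>fst (ah_iter n p q) - sqrt (p * q)\<bar> \<le> \<bar>p - q\<bar> / 2 ^ n"
proof -
  define a h where "a = fst (ah_iter n p q)" and "h = snd (ah_iter n p q)"
  have pos: "0 < a" "0 < h" and prod: "p * q = a * h" and le: "\<bar>a - h\<bar> \<le> \<bar>p - q\<bar> / 2 ^ n"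
    using ah_iter[OF assms, of n] by (simp_all add: a_def h_def)
  have "min a h \<le> sqrt (a * h)"
    by (rule real_le_rsqrt) (use pos in \<open>auto simp: power2_eq_square min_def\<close>)
  moreover have "sqrt (a * h) \<le> max a h"
    by (rule real_le_lsqrt) (use pos in \<open>auto simp: power2_eq_square max_def\<close>)
  ultimately have "\<bar>a - sqrt (p * q)\<bar> \<le> \<bar>a - h\<bar>" unfolding prod by (auto simp: min_def max_def split: if_splits)
  with le show ?thesis by (simp add: a_def)
qed

text \<open>The arithmetic-harmonic iteration started at \<open>f\<close> and \<open>g\<close> stays in the class and converges
  locally uniformly to the geometric mean.\<close>
lemma mean_monotone_sqrt:
  assumes f: "mean_monotone TYPE('a::complex_hilbert) f" and g: "mean_monotone TYPE('a) g"
  shows "mean_monotone TYPE('a) (\<lambda>x. sqrt (f x * g x))"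
proof (rule mean_monotone_uniform_limit)
  note fD = mean_monotoneD[OF f] and gD = mean_monotoneD[OF g]
  have "mean_monotone TYPE('a) (\<lambda>x. fst (ah_iter n (f x) (g x))) \<and>
      mean_monotone TYPE('a) (\<lambda>x. snd (ah_iter n (f x) (g x)))" for n
  proof (induction n)
    case (Suc n)
    let ?a = "\<lambda>x. fst (ah_iter n (f x) (g x))" and ?h = "\<lambda>x. snd (ah_iter n (f x) (g x))"
    have "mean_monotone TYPE('a) (\<lambda>x. (1/2) * (?a x + ?h x))"
      using Suc by (intro mean_monotone_cmult mean_monotone_add) auto
    moreover have "mean_monotone TYPE('a) (\<lambda>x. 2 * (?a x * ?h x / (?a x + ?h x)))"
      using Suc by (intro mean_monotone_cmult mean_monotone_parallel) auto
    ultimately show ?case by (simp add: case_prod_beta Let_def)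
  qed (use f g in simp)
  then show "mean_monotone TYPE('a) (\<lambda>x. fst (ah_iter n (f x) (g x)))" for n by blast
  show "continuous_on {0<..} (\<lambda>x. sqrt (f x * g x))" by (intro continuous_intros fD gD)
  show "0 < sqrt (f x * g x)" if "0 < x" for x using fD(2)[OF that] gD(2)[OF that] by simp
  show "uniform_limit {a..b} (\<lambda>n x. fst (ah_iter n (f x) (g x))) (\<lambda>x. sqrt (f x * g x)) sequentially"
    if a: "0 < a" for a b
  proof (rule uniform_limitI)
    fix e :: real assume "0 < e"
    have "continuous_on {a..b} (\<lambda>x. f x - g x)"
      using a by (intro continuous_on_subset[OF continuous_on_diff[OF fD(1) gD(1)]]) auto
    then have "bounded ((\<lambda>x. f x - g x) ` {a..b})"
      by (intro compact_imp_bounded compact_continuous_image compact_Icc)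
    then obtain K where K: "\<And>x. x \<in> {a..b} \<Longrightarrow> \<bar>f x - g x\<bar> \<le> K"
      unfolding bounded_iff by fastforce
    have "(\<lambda>n. K / 2 ^ n) \<longlonglongrightarrow> 0" by (rule LIMSEQ_divide_realpow_zero) simp
    then have "\<forall>\<^sub>F n in sequentially. K / 2 ^ n < e" using \<open>0 < e\<close> by (rule order_tendstoD(2))
    then show "\<forall>\<^sub>F n in sequentially. \<forall>x\<in>{a..b}.
        dist (fst (ah_iter n (f x) (g x))) (sqrt (f x * g x)) < e"
    proof eventually_elim
      case (elim n)
      show ?case
      proof
        fix x assume x: "x \<in> {a..b}"
        have "\<bar>fst (ah_iter n (f x) (g x)) - sqrt (f x * g x)\<bar> \<le> \<bar>f x - g x\<bar> / 2 ^ n"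
          by (rule ah_iter_close) (use x a fD(2) gD(2) in auto)
        also have "\<dots> \<le> K / 2 ^ n" using K[OF x] by (rule divide_right_mono) simp
        finally show "dist (fst (ah_iter n (f x) (g x))) (sqrt (f x * g x)) < e"
          using elim by (simp add: dist_real_def)
      qed
    qed
  qed
qed

section \<open>From square roots to all exponents in the unit interval\<close>

lemma sqrt_powr_mult_powr: "sqrt (x powr s * x powr t) = x powr ((s + t) / 2)"
proof -
  have "x powr s * x powr t = (x powr ((s + t) / 2))\<^sup>2"
    by (simp add: power2_eq_square flip: powr_add)
  then show ?thesis by simp
qed

text \<open>Each dyadic exponent is the midpoint of two exponents of the previous level, and
  midpoints of exponents are geometric means of powers. Splitting \<open>k\<close> into near halves
  keeps both numerators within \<open>2 ^ n\<close>.\<close>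

lemma mean_monotone_powr_dyadic:
  "k \<le> 2 ^ n \<Longrightarrow> mean_monotone TYPE('a::complex_hilbert) (\<lambda>x. x powr (real k / 2 ^ n))"
proof (induction n arbitrary: k)
  case 0
  then consider "k = 0" | "k = 1" by fastforce
  then show ?case
    by cases (auto intro: mean_monotone_cong[OF mean_monotone_one] mean_monotone_cong[OF mean_monotone_id])
next
  case (Suc n)
  define i j where "i = k div 2" and "j = k - i"
  have k: "k = i + j" "i \<le> 2 ^ n" "j \<le> 2 ^ n" using Suc.prems by (auto simp: i_def j_def)
  have "mean_monotone TYPE('a) (\<lambda>x. sqrt (x powr (real i / 2 ^ n) * x powr (real j / 2 ^ n)))"
    by (intro mean_monotone_sqrt Suc.IH k)
  moreover have "(real i / 2 ^ n + real j / 2 ^ n) / 2 = real k / 2 ^ Suc n"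
    by (simp add: k field_simps)
  ultimately show ?case by (simp only: sqrt_powr_mult_powr)
qed

text \<open>Uniform continuity of \<open>x powr s\<close> in both variables on a compact
  rectangle.\<close>

lemma uniform_limit_powr_exponent:
  fixes v :: "nat \<Rightarrow> real"
  assumes v: "v \<longlonglongrightarrow> u" and a: "0 < a"
  shows "uniform_limit {a..b} (\<lambda>n x. x powr v n) (\<lambda>x. x powr u) sequentially"
proof (rule uniform_limitI)
  fix e :: real assume e: "0 < e"
  let ?K = "{u - 1..u + 1} \<times> {a..b}"
  have "uniformly_continuous_on ?K (\<lambda>(s, x). x powr s)"
    by (rule compact_uniformly_continuous)
      (use a in \<open>auto simp: case_prod_beta intro!: continuous_intros compact_Times\<close>)
  then obtain d where d: "0 < d" "\<And>y z. y \<in> ?K \<Longrightarrow> z \<in> ?K \<Longrightarrow> dist z y < d \<Longrightarrow>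
      dist ((\<lambda>(s, x). x powr s) z) ((\<lambda>(s, x). x powr s) y) < e"
    using e unfolding uniformly_continuous_on_def by blast
  \<comment> \<open>The cap \<open>1\<close> keeps \<open>v n\<close> inside the exponent range of
    \<open>?K\<close>.\<close>
  have "\<forall>\<^sub>F n in sequentially. dist (v n) u < min d 1"
    by (rule tendstoD[OF v]) (use d in simp)
  then show "\<forall>\<^sub>F n in sequentially. \<forall>x\<in>{a..b}. dist (x powr v n) (x powr u) < e"
  proof eventually_elim
    case (elim n)
    show ?case
    proof
      fix x assume "x \<in> {a..b}"
      then show "dist (x powr v n) (x powr u) < e"
        using d(2)[of "(u, x)" "(v n, x)"] elim by (auto simp: dist_Pair_Pair dist_real_def abs_less_iff)
    qed
  qed
qed

lemma mean_monotone_powr: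
  assumes u: "u \<in> {0..1}"
  shows "mean_monotone TYPE('a::complex_hilbert) (\<lambda>x. x powr u)"
proof -
  \<comment> \<open>Rounding down keeps the dyadic exponents at most \<open>1\<close>.\<close>
  define k where "k n = nat \<lfloor>u * 2 ^ n\<rfloor>" for n
  have k: "real (k n) \<le> u * 2 ^ n" "u * 2 ^ n - 1 \<le> real (k n)" for n
    using u by (simp_all add: k_def of_nat_nat)
  have "real (k n) \<le> 2 ^ n" for n
  proof (rule order_trans[OF k(1)])
    show "u * 2 ^ n \<le> 2 ^ n" using u mult_right_mono[of u 1 "2 ^ n"] by simp
  qed
  then have "k n \<le> 2 ^ n" for n by (metis of_nat_le_iff of_nat_numeral of_nat_power)
  then have F: "mean_monotone TYPE('a) (\<lambda>x. x powr (real (k n) / 2 ^ n))" for n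
    by (rule mean_monotone_powr_dyadic)
  have "(\<lambda>n. real (k n) / 2 ^ n) \<longlonglongrightarrow> u"
  proof (rule tendsto_sandwich)
    show "\<forall>\<^sub>F n in sequentially. u - 1 / 2 ^ n \<le> real (k n) / 2 ^ n"
    proof (intro always_eventually allI)
      fix n
      have "(u * 2 ^ n - 1) / 2 ^ n \<le> real (k n) / 2 ^ n" by (intro divide_right_mono k) simp
      then show "u - 1 / 2 ^ n \<le> real (k n) / 2 ^ n" by (simp add: diff_divide_distrib)
    qed
    show "\<forall>\<^sub>F n in sequentially. real (k n) / 2 ^ n \<le> u"
      using k(1) by (simp add: divide_le_eq)
    have "(\<lambda>n. 1 / 2 ^ n :: real) \<longlonglongrightarrow> 0" by (rule LIMSEQ_divide_realpow_zero) simp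
    from tendsto_diff[OF tendsto_const this, of u]
    show "(\<lambda>n. u - 1 / 2 ^ n) \<longlonglongrightarrow> u" by simp
  qed simp
  from uniform_limit_powr_exponent[OF this]
  show ?thesis
    by (intro mean_monotone_uniform_limit[OF F]) (auto intro!: continuous_intros)
qed

lemma geo_mean_inv_mono:
  fixes A B :: "'a::complex_hilbert bounded_op"
  assumes "u \<in> {0..1}" "op_pos A" "op_pos B" "A \<le> A'" "B \<le> B'"
  shows "geo_mean_inv A u B \<le> geo_mean_inv A' u B'"
  unfolding geo_mean_inv_eq_op_mean
  using mean_monotoneD(3)[OF mean_monotone_powr[OF assms(1), where 'a = 'a]] assms(2-) by (simp add: op_pair_def)

section \<open>Strong limits and positive combinations of geometric means\<close>

text \<open>For the decrease \<open>D\<close> of \<open>G\<close> between two parameters, \<open>\<parallel>D x\<parallel>\<^sup>2 \<le> c \<langle>D x, x\<rangle>\<close>, so strong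
  convergence follows from convergence of the monotone bounded forms \<open>\<langle>G \<epsilon> x, x\<rangle>\<close>.\<close>
lemma op_mono_strong_limit:
  fixes G :: "real \<Rightarrow> 'a::complex_hilbert bounded_op"
  assumes nonneg: "\<And>e. 0 < e \<Longrightarrow> 0 \<le> G e" and mono: "\<And>d e. 0 < d \<Longrightarrow> d \<le> e \<Longrightarrow> G d \<le> G e"
  shows "\<exists>S. \<forall>x. ((\<lambda>e. op_apply (G e) x) \<longlongrightarrow> op_apply S x) (at_right 0)"
proof -
  define c where "c = norm (G 1) + 1"
  have c: "0 < c" by (simp add: c_def add_nonneg_pos)
  have le_c: "G e \<le> c *\<^sub>R 1" if "0 < e" "e \<le> 1" for e
  proof -
    have "G e \<le> G 1" using that by (rule mono)
    also have "\<dots> \<le> norm (G 1) *\<^sub>R 1" by (intro op_selfadj_le_norm op_selfadjI nonneg) simp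
    also have "\<dots> \<le> c *\<^sub>R 1" by (rule op_scaleR_one_mono) (simp add: c_def)
    finally show ?thesis .
  qed
  have small: "\<forall>\<^sub>F e in at_right (0 :: real). 0 < e \<and> e \<le> d" if "0 < d" for d
    using that by (auto simp: eventually_at_right_field intro!: exI[of _ d])
  have "\<exists>l. ((\<lambda>e. op_apply (G e) x) \<longlongrightarrow> l) (at_right 0)" for x
  proof -
    define L where "L = Inf ((\<lambda>e. op_qform (G e) x) ` {0<..})"
    have bdd: "bdd_below ((\<lambda>e. op_qform (G e) x) ` {0<..})"
      by (rule bdd_belowI[of _ 0]) (use nonneg in \<open>auto simp: op_nonneg_iff\<close>)
    have L_le: "L \<le> op_qform (G e) x" if "0 < e" for e
      unfolding L_def by (rule cInf_lower[OF _ bdd]) (use that in auto)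
    have "cauchy_filter (filtermap (\<lambda>e. op_apply (G e) x) (at_right 0))"
      unfolding cauchy_filter_metric_filtermap
    proof (intro allI impI)
      fix \<delta> :: real assume \<delta>: "0 < \<delta>"
      \<comment> \<open>Chosen so that \<open>c * \<eta>\<close> is the square of
        \<open>\<delta> / 2\<close>, the bound required of the squared norm.\<close>
      define \<eta> where "\<eta> = (\<delta> / 2)\<^sup>2 / c"
      have "0 < \<eta>" using \<delta> c by (simp add: \<eta>_def)
      then have "Inf ((\<lambda>e. op_qform (G e) x) ` {0<..}) < L + \<eta>" by (simp add: L_def)
      then obtain e0 where e0: "0 < e0" "op_qform (G e0) x < L + \<eta>"
        by (rule cInf_lessD[rotated, THEN bexE]) auto
      \<comment> \<open>Up to parameter \<open>1\<close> the bound \<open>c\<close> is available,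
        and lowering the parameter only lowers the form.\<close>
      define e1 where "e1 = min e0 1"
      have e1: "0 < e1" "e1 \<le> 1" "op_qform (G e1) x < L + \<eta>"
        using e0 mono[of e1 e0] by (auto simp: e1_def le_bounded_op_iff intro: le_less_trans)
      have close: "norm (op_apply (G e1) x - op_apply (G e) x) < \<delta> / 2" if e: "0 < e" "e \<le> e1" for e
      proof -
        have "0 \<le> G e1 - G e" using mono[OF e] by simp
        moreover have "G e1 - G e \<le> c *\<^sub>R 1"
          using le_c[of e1] e1 nonneg[OF e(1)] by (meson diff_le_eq le_add_same_cancel1 order_trans)
        ultimately have "(norm (op_apply (G e1 - G e) x))\<^sup>2 \<le> c * op_qform (G e1 - G e) x"
          using c by (rule norm_op_apply_square_le)
        also have "\<dots> < c * \<eta>"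
          using e1(3) L_le[OF e(1)] c by (simp add: op_qform_simps)
        also have "\<dots> = (\<delta> / 2)\<^sup>2" using c by (simp add: \<eta>_def)
        finally show ?thesis
          unfolding op_apply_simps using power_less_imp_less_base \<delta> by fastforce
      qed
      show "\<exists>P. eventually P (at_right 0) \<and>
          (\<forall>d e. P d \<and> P e \<longrightarrow> dist (op_apply (G d) x) (op_apply (G e) x) < \<delta>)"
      proof (intro exI conjI allI impI)
        show "\<forall>\<^sub>F e in at_right 0. 0 < e \<and> e \<le> e1" by (rule small[OF e1(1)])
        fix d e assume "(0 < d \<and> d \<le> e1) \<and> (0 < e \<and> e \<le> e1)"
        then have "dist (op_apply (G e1) x) (op_apply (G d) x) < \<delta> / 2"
          "dist (op_apply (G e1) x) (op_apply (G e) x) < \<delta> / 2"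
          using close by (auto simp: dist_norm)
        then show "dist (op_apply (G d) x) (op_apply (G e) x) < \<delta>"
          using dist_triangle_half_r by blast
      qed
    qed
    moreover have "filtermap (\<lambda>e. op_apply (G e) x) (at_right 0) \<noteq> bot"
      by (simp add: filtermap_bot_iff)
    ultimately show ?thesis
      using complete_UNIV[where 'a = 'a, unfolded complete_uniform] unfolding filterlim_def
      by (metis principal_le_iff top_greatest principal_UNIV)
  qed
  then obtain L where L: "\<And>x. ((\<lambda>e. op_apply (G e) x) \<longlongrightarrow> L x) (at_right 0)" by metis
  have "\<forall>\<^sub>F e in at_right 0. norm (op_apply (G e) x) \<le> c * norm x" for x
    using small[of 1, simplified]
  proof eventually_elim
    case (elim e)
    then have "norm (G e) \<le> c" by (intro norm_op_le nonneg le_c c) auto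
    then show ?case using norm_op_apply_le[of "G e" x] mult_right_mono[of "norm (G e)" c "norm x"] by simp
  qed
  from strong_limit_exists[OF L trivial_limit_at_right_real this]
  obtain S where "\<And>x. op_apply S x = L x" by blast
  with L show ?thesis by metis
qed

text \<open>Justifies the description in \<open>geo_mean\<close>: the regularized means decrease
  with the parameter, and limits of vectors are unique.\<close>

lemma geo_mean_tendsto:
  fixes A B :: "'a::complex_hilbert bounded_op"
  assumes A: "0 \<le> A" and B: "0 \<le> B" and u: "u \<in> {0..1}"
    and singular: "\<not> (op_invertible A \<and> op_invertible B)"
  shows "((\<lambda>e. op_apply (geo_mean_inv (A + e *\<^sub>R 1) u (B + e *\<^sub>R 1)) x)
    \<longlongrightarrow> op_apply (A \<sharp>\<^bsub>u\<^esub> B) x) (at_right 0)"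
proof -
  let ?G = "\<lambda>e. geo_mean_inv (A + e *\<^sub>R 1) u (B + e *\<^sub>R 1)"
  have "\<exists>S. \<forall>x. ((\<lambda>e. op_apply (?G e) x) \<longlongrightarrow> op_apply S x) (at_right 0)"
  proof (rule op_mono_strong_limit)
    fix e :: real assume e: "0 < e"
    then have P: "op_pair (A + e *\<^sub>R 1) (B + e *\<^sub>R 1)"
      by (simp add: op_pair_def op_pos_add_scaleR A B)
    show "0 \<le> ?G e" unfolding geo_mean_inv_eq_op_mean
      by (rule op_pair.mean_nonneg[OF P]) (auto intro!: continuous_intros)
  next
    fix d e :: real assume d: "0 < d" "d \<le> e"
    show "?G d \<le> ?G e"
      by (intro geo_mean_inv_mono u op_pos_add_scaleR A B d add_left_mono op_scaleR_one_mono)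
  qed
  then obtain S where S: "\<forall>x. ((\<lambda>e. op_apply (?G e) x) \<longlongrightarrow> op_apply S x) (at_right 0)" by blast
  have "A \<sharp>\<^bsub>u\<^esub> B = (THE S. \<forall>x. ((\<lambda>e. op_apply (?G e) x) \<longlongrightarrow> op_apply S x) (at_right 0))"
    unfolding geo_mean_def using singular by (simp only: if_False)
  also have "\<dots> = S"
  proof (rule the_equality)
    show "\<forall>x. ((\<lambda>e. op_apply (?G e) x) \<longlongrightarrow> op_apply S x) (at_right 0)" by (rule S)
  next
    fix S' assume S': "\<forall>x. ((\<lambda>e. op_apply (?G e) x) \<longlongrightarrow> op_apply S' x) (at_right 0)"
    show "S' = S"
      by (rule bounded_op_eqI)
        (rule tendsto_unique[OF trivial_limit_at_right_real S'[rule_format] S[rule_format]])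
  qed
  finally show ?thesis using S by simp
qed

text \<open>Five terms cover every inequality used later: \<open>1\<close>, \<open>x\<close>, and
  the powers \<open>t\<close>, \<open>1/2\<close> and one of \<open>1/4\<close>, \<open>3/4\<close>.
  Shorter inequalities are padded with zero coefficients.\<close>

lemma (in op_pair) geo_mean_inv_combination_nonneg:
  assumes "\<And>x. 0 < x \<Longrightarrow> 0 \<le> a + b * x + c\<^sub>1 * x powr u + c\<^sub>2 * x powr v + c\<^sub>3 * x powr w"
  shows "0 \<le> a *\<^sub>R A + b *\<^sub>R B + c\<^sub>1 *\<^sub>R geo_mean_inv A u B + c\<^sub>2 *\<^sub>R geo_mean_inv A v B
    + c\<^sub>3 *\<^sub>R geo_mean_inv A w B"
proof -
  have cont: "continuous_on {0<..} (\<lambda>x. c * x powr s)" "continuous_on {0<..} (\<lambda>x. x powr s)"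
    for c s :: real
    by (auto intro!: continuous_intros)
  have "0 \<le> op_mean (\<lambda>x. a + b * x + c\<^sub>1 * x powr u + c\<^sub>2 * x powr v + c\<^sub>3 * x powr w) A B"
    by (rule mean_nonneg[OF _ assms]) (intro continuous_intros cont)
  also have "\<dots> = op_mean (\<lambda>_. a) A B + op_mean (\<lambda>x. b * x) A B + op_mean (\<lambda>x. c\<^sub>1 * x powr u) A B
      + op_mean (\<lambda>x. c\<^sub>2 * x powr v) A B + op_mean (\<lambda>x. c\<^sub>3 * x powr w) A B"
    by (subst mean_add, (intro continuous_intros cont)+)+ (rule refl)
  also have "\<dots> = a *\<^sub>R A + b *\<^sub>R B + c\<^sub>1 *\<^sub>R geo_mean_inv A u B + c\<^sub>2 *\<^sub>R geo_mean_inv A v B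
    + c\<^sub>3 *\<^sub>R geo_mean_inv A w B"
    by (simp add: mean_const mean_id mean_cmult cont geo_mean_inv_eq_op_mean)
  finally show ?thesis .
qed

lemma geo_mean_combination_nonneg:
  fixes A B :: "'a::complex_hilbert bounded_op"
  assumes A: "0 \<le> A" and B: "0 \<le> B" and uvw: "u \<in> {0..1}" "v \<in> {0..1}" "w \<in> {0..1}"
    and nonneg: "\<And>x. 0 < x \<Longrightarrow> 0 \<le> a + b * x + c\<^sub>1 * x powr u + c\<^sub>2 * x powr v + c\<^sub>3 * x powr w"
  shows "0 \<le> a *\<^sub>R A + b *\<^sub>R B + c\<^sub>1 *\<^sub>R (A \<sharp>\<^bsub>u\<^esub> B) + c\<^sub>2 *\<^sub>R (A \<sharp>\<^bsub>v\<^esub> B)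
    + c\<^sub>3 *\<^sub>R (A \<sharp>\<^bsub>w\<^esub> B)"
proof (cases "op_invertible A \<and> op_invertible B")
  case True
  then interpret op_pair A B by unfold_locales (simp_all add: op_pos_iff A B)
  show ?thesis
    using geo_mean_inv_combination_nonneg[OF nonneg] True by (simp add: geo_mean_def)
next
  case False
  note lim = geo_mean_tendsto[OF A B _ False]
  define A' B' where "A' e = A + e *\<^sub>R 1" and "B' e = B + e *\<^sub>R 1" for e :: real
  have base: "((\<lambda>e. op_apply (C + e *\<^sub>R 1) x) \<longlongrightarrow> op_apply C x) (at_right 0)"
    for C :: "'a bounded_op" and x
  proof -
    have "((\<lambda>e. op_apply C x + e *\<^sub>R x) \<longlongrightarrow> op_apply C x + 0 *\<^sub>R x) (at_right 0)"
      by (intro tendsto_intros)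
    then show ?thesis by (simp add: op_apply_simps)
  qed
  show ?thesis
  proof (rule op_nonneg_tendsto_strong)
    show "((\<lambda>e. op_apply (a *\<^sub>R A' e + b *\<^sub>R B' e + c\<^sub>1 *\<^sub>R geo_mean_inv (A' e) u (B' e)
          + c\<^sub>2 *\<^sub>R geo_mean_inv (A' e) v (B' e) + c\<^sub>3 *\<^sub>R geo_mean_inv (A' e) w (B' e)) x)
        \<longlongrightarrow> op_apply (a *\<^sub>R A + b *\<^sub>R B + c\<^sub>1 *\<^sub>R (A \<sharp>\<^bsub>u\<^esub> B) + c\<^sub>2 *\<^sub>R (A \<sharp>\<^bsub>v\<^esub> B)
          + c\<^sub>3 *\<^sub>R (A \<sharp>\<^bsub>w\<^esub> B)) x) (at_right 0)" for x
      unfolding plus_bounded_op.rep_eq scaleR_bounded_op.rep_eq A'_def B'_def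
      using lim[OF uvw(1), of x] lim[OF uvw(2), of x] lim[OF uvw(3), of x] base[of A x] base[of B x]
      unfolding plus_bounded_op.rep_eq scaleR_bounded_op.rep_eq
      by (intro tendsto_add tendsto_scaleR tendsto_const)
    show "\<forall>\<^sub>F e in at_right 0. 0 \<le> a *\<^sub>R A' e + b *\<^sub>R B' e + c\<^sub>1 *\<^sub>R geo_mean_inv (A' e) u (B' e)
          + c\<^sub>2 *\<^sub>R geo_mean_inv (A' e) v (B' e) + c\<^sub>3 *\<^sub>R geo_mean_inv (A' e) w (B' e)"
      using eventually_at_right_less[of 0]
    proof eventually_elim
      case (elim e)
      then interpret op_pair "A' e" "B' e"
        by unfold_locales (simp_all add: A'_def B'_def op_pos_add_scaleR A B)
      show ?case by (rule geo_mean_inv_combination_nonneg[OF nonneg])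
    qed
  qed simp
qed

section \<open>Scalar Young inequalities\<close>

text \<open>As a function of the exponent, \<open>x powr s\<close> is an exponential, hence convex
  and below its chords.\<close>

lemma weighted_AM_GM_powr:
  fixes x :: real
  assumes "0 < x" "0 \<le> w" "w \<le> 1"
  shows "x powr ((1 - w) * s + w * t) \<le> (1 - w) * x powr s + w * x powr t"
proof -
  have "exp ((1 - w) *\<^sub>R (s * ln x) + w *\<^sub>R (t * ln x)) \<le> (1 - w) * exp (s * ln x) + w * exp (t * ln x)"
    by (rule convex_onD[OF exp_convex]) (use assms in auto)
  with assms show ?thesis by (simp add: powr_def algebra_simps)
qed

text \<open>Since \<open>1/2\<close> is the midpoint of \<open>s\<close> and \<open>1 - s\<close>,
  an upper bound at \<open>1 - t\<close> becomes a lower bound at \<open>t\<close>.\<close>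

lemma two_powr_half_le:
  fixes x :: real
  assumes "0 < x"
  shows "2 * x powr (1/2) \<le> x powr s + x powr (1 - s)"
  using weighted_AM_GM_powr[OF assms, of "1/2" s "1 - s"] by (simp add: field_simps)

text \<open>The right-hand side is the chord interpolant of \<open>x powr t\<close> with nodes
  \<open>0\<close>, \<open>1/4\<close>, \<open>1/2\<close>: the chord from \<open>0\<close> to
  \<open>1/2\<close>, lowered by a tent that makes it exact at \<open>1/4\<close>.\<close>

lemma refined_Young_le:
  fixes x t :: real
  assumes x: "0 < x" and t: "0 < t" "t \<le> 1/2" and r0: "r0 = min (2 * t) (1 - 2 * t)"
  shows "x powr t \<le> (1 - 2 * t) + (2 * t) * x powr (1/2) - r0 * (x powr (1/2) + 1 - 2 * x powr (1/4))"
proof (cases "t \<le> 1/4")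
  case True
  then have "x powr t \<le> (1 - 4 * t) + 4 * t * x powr (1/4)"
    using weighted_AM_GM_powr[OF x, of "4 * t" 0 "1/4"] t x by simp
  moreover have r0: "r0 = 2 * t" using True r0 by simp
  ultimately show ?thesis unfolding r0 by (simp add: algebra_simps)
next
  case False
  \<comment> \<open>The weight \<open>4 * t - 1\<close> is the relative position of \<open>t\<close>
    between \<open>1/4\<close> and \<open>1/2\<close>.\<close>
  have "x powr ((1 - (4 * t - 1)) * (1/4) + (4 * t - 1) * (1/2))
      \<le> (1 - (4 * t - 1)) * x powr (1/4) + (4 * t - 1) * x powr (1/2)"
    by (rule weighted_AM_GM_powr[OF x]) (use False t in auto)
  also have "(1 - (4 * t - 1)) * (1/4) + (4 * t - 1) * (1/2) = t" by (simp add: field_simps)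
  finally have "x powr t \<le> (2 - 4 * t) * x powr (1/4) + (4 * t - 1) * x powr (1/2)" by simp
  moreover have r0: "r0 = 1 - 2 * t" using False r0 by simp
  ultimately show ?thesis unfolding r0 by (simp add: algebra_simps)
qed

text \<open>Interpolate \<open>x powr (1 - t)\<close> from above with nodes \<open>1/2\<close>,
  \<open>3/4\<close>, \<open>1\<close> and subtract the result from
  \<open>2 * x powr (1/2)\<close>.\<close>

lemma refined_Young_ge:
  fixes x t :: real
  assumes x: "0 < x" and t: "0 < t" "t \<le> 1/2" and r0: "r0 = min (2 * t) (1 - 2 * t)"
  shows "x powr t \<ge> (2 * t - 1) * x + (2 - 2 * t) * x powr (1/2)
    + r0 * (x powr (1/2) + x - 2 * x powr (3/4))"
proof (cases "t \<le> 1/4")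
  case True
  have "x powr ((1 - 4 * t) * 1 + 4 * t * (3/4)) \<le> (1 - 4 * t) * x powr 1 + 4 * t * x powr (3/4)"
    by (rule weighted_AM_GM_powr[OF x]) (use True t in auto)
  also have "(1 - 4 * t) * 1 + 4 * t * (3/4) = 1 - t" by simp
  finally have "x powr (1 - t) \<le> (1 - 4 * t) * x + 4 * t * x powr (3/4)" using x by simp
  moreover have r0: "r0 = 2 * t" using True r0 by simp
  ultimately show ?thesis unfolding r0 using two_powr_half_le[OF x, of t] by (simp add: algebra_simps)
next
  case False
  have "x powr ((1 - (4 * t - 1)) * (3/4) + (4 * t - 1) * (1/2))
      \<le> (1 - (4 * t - 1)) * x powr (3/4) + (4 * t - 1) * x powr (1/2)"
    by (rule weighted_AM_GM_powr[OF x]) (use False t in auto)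
  also have "(1 - (4 * t - 1)) * (3/4) + (4 * t - 1) * (1/2) = 1 - t" by (simp add: field_simps)
  finally have "x powr (1 - t) \<le> (2 - 4 * t) * x powr (3/4) + (4 * t - 1) * x powr (1/2)" by simp
  moreover have r0: "r0 = 1 - 2 * t" using False r0 by simp
  ultimately show ?thesis unfolding r0 using two_powr_half_le[OF x, of t] by (simp add: algebra_simps)
qed


lemma clinear_scaleR: "clinear \<Phi> \<Longrightarrow> \<Phi> (c *\<^sub>R X) = c *\<^sub>R \<Phi> X"
  by (simp add: clinear_iff scaleR_scaleC)

lemma clinear_add: "clinear \<Phi> \<Longrightarrow> \<Phi> (X + Y) = \<Phi> X + \<Phi> Y"
  by (simp add: clinear_iff)

text \<open>The scalar form of exchanging the two operators: it swaps the weights \<open>s\<close>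
  and \<open>1 - s\<close>.\<close>

lemma powr_reflect: "0 < x \<Longrightarrow> x * inverse x powr s = x powr (1 - s)" for x :: real
  by (simp add: inverse_powr powr_diff powr_minus divide_inverse)

text \<open>The reflection of \<open>refined_Young_le\<close> at weight \<open>1 - t\<close>:
  \<open>1\<close> and \<open>x\<close> change places, and \<open>1/4\<close> becomes
  \<open>3/4\<close>.\<close>

lemma refined_Young_le':
  fixes x t :: real
  assumes x: "0 < x" and t: "1/2 \<le> t" "t < 1" and r0: "r0 = min (2 * (1 - t)) (1 - 2 * (1 - t))"
  shows "x powr t \<le> (2 * t - 1) * x + (2 - 2 * t) * x powr (1/2)
    - r0 * (x powr (1/2) + x - 2 * x powr (3/4))"
proof -
  have "inverse x powr (1 - t) \<le> (1 - 2 * (1 - t)) + (2 * (1 - t)) * inverse x powr (1/2)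
      - r0 * (inverse x powr (1/2) + 1 - 2 * inverse x powr (1/4))"
    by (rule refined_Young_le) (use x t r0 in auto)
  from mult_left_mono[OF this less_imp_le[OF x]]
  have "x * inverse x powr (1 - t) \<le> (2 * t - 1) * x + (2 - 2 * t) * (x * inverse x powr (1/2))
      - r0 * (x * inverse x powr (1/2) + x - 2 * (x * inverse x powr (1/4)))"
    by (simp add: algebra_simps)
  then show ?thesis unfolding powr_reflect[OF x] by simp
qed

lemma refined_Young_ge':
  fixes x t :: real
  assumes x: "0 < x" and t: "1/2 \<le> t" "t < 1" and r0: "r0 = min (2 * (1 - t)) (1 - 2 * (1 - t))"
  shows "x powr t \<ge> (1 - 2 * t) + (2 * t) * x powr (1/2)
    + r0 * (x powr (1/2) + 1 - 2 * x powr (1/4))"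
proof -
  have "inverse x powr (1 - t) \<ge> (2 * (1 - t) - 1) * inverse x + (2 - 2 * (1 - t)) * inverse x powr (1/2)
      + r0 * (inverse x powr (1/2) + inverse x - 2 * inverse x powr (3/4))"
    by (rule refined_Young_ge) (use x t r0 in auto)
  moreover have mult_inverse: "x * (inverse x * y) = y" for y
    using x by (simp flip: mult.assoc)
  ultimately have "x * inverse x powr (1 - t) \<ge> x * ((2 * (1 - t) - 1) * inverse x
      + (2 - 2 * (1 - t)) * inverse x powr (1/2)
      + r0 * (inverse x powr (1/2) + inverse x - 2 * inverse x powr (3/4)))"
    using x by (intro mult_left_mono) simp_all
  then have "x * inverse x powr (1 - t) \<ge> (1 - 2 * t) + (2 * t) * (x * inverse x powr (1/2))
      + r0 * (x * inverse x powr (1/2) + 1 - 2 * (x * inverse x powr (3/4)))"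
    using x by (simp add: algebra_simps mult_inverse)
  then show ?thesis unfolding powr_reflect[OF x] by simp
qed

section \<open>Assembling the operator inequality\<close>

text \<open>The \<open>M\<close> are means of images and the \<open>N\<close> images of means. An
  abstract ordered space serves both cases: for \<open>t > 1/2\<close> the roles of \<open>P\<close>
  and \<open>Q\<close> are exchanged and \<open>r\<close> is \<open>1 - t\<close>.\<close>

lemma combine_mean_bounds:
  fixes P Q M M\<^sub>h M\<^sub>1 N N\<^sub>h N\<^sub>3 :: "'a::ordered_real_vector" and r r0 :: real
  assumes upper: "0 \<le> (1 - 2 * r - r0) *\<^sub>R P - M + (2 * r - r0) *\<^sub>R M\<^sub>h + (2 * r0) *\<^sub>R M\<^sub>1"
    and lower: "0 \<le> (1 - 2 * r - r0) *\<^sub>R Q + N + (2 * r - 2 - r0) *\<^sub>R N\<^sub>h + (2 * r0) *\<^sub>R N\<^sub>3"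
    and amgm: "0 \<le> P + Q - 2 *\<^sub>R M\<^sub>h" "0 \<le> M\<^sub>h + P - 2 *\<^sub>R M\<^sub>1" "0 \<le> N\<^sub>h + Q - 2 *\<^sub>R N\<^sub>3"
    and r: "0 \<le> r" "0 \<le> r0"
  defines "E \<equiv> (2 * (1 - r)) *\<^sub>R (M\<^sub>h - N\<^sub>h + (1/2) *\<^sub>R (P + Q - 2 *\<^sub>R M\<^sub>h))"
  shows "M - N \<le> E - r0 *\<^sub>R (N\<^sub>h + Q - 2 *\<^sub>R N\<^sub>3) - r0 *\<^sub>R (M\<^sub>h + P - 2 *\<^sub>R M\<^sub>1)"
    and "E - r0 *\<^sub>R (N\<^sub>h + Q - 2 *\<^sub>R N\<^sub>3) - r0 *\<^sub>R (M\<^sub>h + P - 2 *\<^sub>R M\<^sub>1) \<le> E"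
proof -
  \<comment> \<open>The terms \<open>M\<^sub>h\<close> cancel inside \<open>E\<close>, leaving
    weight \<open>1 - r\<close> on \<open>P + Q\<close>. The two Young bounds provide only
    \<open>1 - 2 * r\<close>; the missing \<open>r\<close> is the arithmetic-geometric term.\<close>
  have "E - r0 *\<^sub>R (N\<^sub>h + Q - 2 *\<^sub>R N\<^sub>3) - r0 *\<^sub>R (M\<^sub>h + P - 2 *\<^sub>R M\<^sub>1) - (M - N)
      = ((1 - 2 * r - r0) *\<^sub>R P - M + (2 * r - r0) *\<^sub>R M\<^sub>h + (2 * r0) *\<^sub>R M\<^sub>1)
      + ((1 - 2 * r - r0) *\<^sub>R Q + N + (2 * r - 2 - r0) *\<^sub>R N\<^sub>h + (2 * r0) *\<^sub>R N\<^sub>3)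
      + r *\<^sub>R (P + Q - 2 *\<^sub>R M\<^sub>h)"
    by (simp add: E_def algebra_simps flip: scaleR_2)
  also have "0 \<le> \<dots>"
    by (rule add_nonneg_nonneg[OF add_nonneg_nonneg[OF upper lower] scaleR_nonneg_nonneg[OF r(1) amgm(1)]])
  finally show "M - N \<le> E - r0 *\<^sub>R (N\<^sub>h + Q - 2 *\<^sub>R N\<^sub>3) - r0 *\<^sub>R (M\<^sub>h + P - 2 *\<^sub>R M\<^sub>1)"
    by simp
  have "X - Y - Z \<le> X" if "0 \<le> Y" "0 \<le> Z" for X Y Z :: 'a
    by (rule order_trans[of _ "X - Y"]) (use that in \<open>simp_all add: diff_le_eq\<close>)
  then show "E - r0 *\<^sub>R (N\<^sub>h + Q - 2 *\<^sub>R N\<^sub>3) - r0 *\<^sub>R (M\<^sub>h + P - 2 *\<^sub>R M\<^sub>1) \<le> E"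
    using amgm r by (simp add: scaleR_nonneg_nonneg)
qed

theorem corollary2p7:
  fixes A B :: "'h::complex_hilbert bounded_op"
    and \<Phi> :: "'h bounded_op \<Rightarrow> 'h bounded_op"
    and t r R r0 :: real
  assumes "0 \<le> A" and "op_invertible A"
    and "0 \<le> B" and "op_invertible B"
    and "clinear \<Phi>" and "positive_map \<Phi>"
    and "t \<in> {0..1}"
    and "r = min t (1 - t)" and "R = max t (1 - t)" and "r0 = min (2 * r) (1 - 2 * r)"
  shows
    "(0 < t \<and> t \<le> 1/2 \<longrightarrow>
        (\<Phi> A \<sharp>\<^bsub>t\<^esub> \<Phi> B) - \<Phi> (A \<sharp>\<^bsub>t\<^esub> B)
          \<le> (2 * R) *\<^sub>R ((\<Phi> A \<sharp> \<Phi> B) - \<Phi> (A \<sharp> B)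
                + (1/2) *\<^sub>R (\<Phi> A + \<Phi> B - 2 *\<^sub>R (\<Phi> A \<sharp> \<Phi> B)))
            - r0 *\<^sub>R (\<Phi> (A \<sharp> B) + \<Phi> B - 2 *\<^sub>R \<Phi> (A \<sharp>\<^bsub>3/4\<^esub> B))
            - r0 *\<^sub>R ((\<Phi> A \<sharp> \<Phi> B) + \<Phi> A - 2 *\<^sub>R (\<Phi> A \<sharp>\<^bsub>1/4\<^esub> \<Phi> B))
        \<and>
        (2 * R) *\<^sub>R ((\<Phi> A \<sharp> \<Phi> B) - \<Phi> (A \<sharp> B)
                + (1/2) *\<^sub>R (\<Phi> A + \<Phi> B - 2 *\<^sub>R (\<Phi> A \<sharp> \<Phi> B)))
            - r0 *\<^sub>R (\<Phi> (A \<sharp> B) + \<Phi> B - 2 *\<^sub>R \<Phi> (A \<sharp>\<^bsub>3/4\<^esub> B))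
            - r0 *\<^sub>R ((\<Phi> A \<sharp> \<Phi> B) + \<Phi> A - 2 *\<^sub>R (\<Phi> A \<sharp>\<^bsub>1/4\<^esub> \<Phi> B))
          \<le> (2 * R) *\<^sub>R ((\<Phi> A \<sharp> \<Phi> B) - \<Phi> (A \<sharp> B)
                + (1/2) *\<^sub>R (\<Phi> A + \<Phi> B - 2 *\<^sub>R (\<Phi> A \<sharp> \<Phi> B))))
     \<and>
     (1/2 < t \<and> t < 1 \<longrightarrow>
        (\<Phi> A \<sharp>\<^bsub>t\<^esub> \<Phi> B) - \<Phi> (A \<sharp>\<^bsub>t\<^esub> B)
          \<le> (2 * R) *\<^sub>R ((\<Phi> A \<sharp> \<Phi> B) - \<Phi> (A \<sharp> B)
                + (1/2) *\<^sub>R (\<Phi> A + \<Phi> B - 2 *\<^sub>R (\<Phi> A \<sharp> \<Phi> B)))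
            - r0 *\<^sub>R ((\<Phi> A \<sharp> \<Phi> B) + \<Phi> B - 2 *\<^sub>R (\<Phi> A \<sharp>\<^bsub>3/4\<^esub> \<Phi> B))
            - r0 *\<^sub>R (\<Phi> (A \<sharp> B) + \<Phi> A - 2 *\<^sub>R \<Phi> (A \<sharp>\<^bsub>1/4\<^esub> B))
        \<and>
        (2 * R) *\<^sub>R ((\<Phi> A \<sharp> \<Phi> B) - \<Phi> (A \<sharp> B)
                + (1/2) *\<^sub>R (\<Phi> A + \<Phi> B - 2 *\<^sub>R (\<Phi> A \<sharp> \<Phi> B)))
            - r0 *\<^sub>R ((\<Phi> A \<sharp> \<Phi> B) + \<Phi> B - 2 *\<^sub>R (\<Phi> A \<sharp>\<^bsub>3/4\<^esub> \<Phi> B))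
            - r0 *\<^sub>R (\<Phi> (A \<sharp> B) + \<Phi> A - 2 *\<^sub>R \<Phi> (A \<sharp>\<^bsub>1/4\<^esub> B))
          \<le> (2 * R) *\<^sub>R ((\<Phi> A \<sharp> \<Phi> B) - \<Phi> (A \<sharp> B)
                + (1/2) *\<^sub>R (\<Phi> A + \<Phi> B - 2 *\<^sub>R (\<Phi> A \<sharp> \<Phi> B))))"
  (is "(_ \<longrightarrow> _ \<le> ?E - ?I1 - ?I2 \<and> _) \<and> (_ \<longrightarrow> _ \<le> _ - ?J1 - ?J2 \<and> _)")
proof -
  note hyp = assms(1-6)
  define P Q where "P = \<Phi> A" and "Q = \<Phi> B"
  have pos: "0 \<le> P" "0 \<le> Q"
    using hyp by (simp_all add: P_def Q_def positive_map_def)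
  note lin = clinear_add[OF hyp(5)] clinear_scaleR[OF hyp(5)]
  have mid: "0 \<le> P + Q - 2 *\<^sub>R (P \<sharp> Q)"
  proof -
    have "0 \<le> 1 *\<^sub>R P + 1 *\<^sub>R Q + (-2) *\<^sub>R (P \<sharp>\<^bsub>1/2\<^esub> Q) + 0 *\<^sub>R (P \<sharp>\<^bsub>1/2\<^esub> Q)
        + 0 *\<^sub>R (P \<sharp>\<^bsub>1/2\<^esub> Q)"
    proof (rule geo_mean_combination_nonneg[OF pos])
      show "0 \<le> 1 + 1 * x + -2 * x powr (1/2) + 0 * x powr (1/2) + 0 * x powr (1/2)"
        if "0 < x" for x :: real
        using two_powr_half_le[OF that, of 0] that by simp
    qed auto
    then show ?thesis by simp
  qed
  \<comment> \<open>The combination is formed for \<open>A\<close> and \<open>B\<close> first, so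
    that linearity and positivity alone carry it through \<Phi>.\<close>
  have image: "0 \<le> a *\<^sub>R P + b *\<^sub>R Q + c\<^sub>1 *\<^sub>R \<Phi> (A \<sharp>\<^bsub>u\<^esub> B) + c\<^sub>2 *\<^sub>R \<Phi> (A \<sharp>\<^bsub>v\<^esub> B)
      + c\<^sub>3 *\<^sub>R \<Phi> (A \<sharp>\<^bsub>w\<^esub> B)"
    if "u \<in> {0..1}" "v \<in> {0..1}" "w \<in> {0..1}"
      "\<And>x. 0 < x \<Longrightarrow> 0 \<le> a + b * x + c\<^sub>1 * x powr u + c\<^sub>2 * x powr v + c\<^sub>3 * x powr w"
    for a b c\<^sub>1 c\<^sub>2 c\<^sub>3 u v w
  proof -
    have "0 \<le> \<Phi> (a *\<^sub>R A + b *\<^sub>R B + c\<^sub>1 *\<^sub>R (A \<sharp>\<^bsub>u\<^esub> B) + c\<^sub>2 *\<^sub>R (A \<sharp>\<^bsub>v\<^esub> B)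
        + c\<^sub>3 *\<^sub>R (A \<sharp>\<^bsub>w\<^esub> B))"
      using geo_mean_combination_nonneg[OF hyp(1,3) that] hyp(6) by (simp add: positive_map_def)
    then show ?thesis by (simp only: lin P_def Q_def)
  qed
  note comb = geo_mean_combination_nonneg[OF pos]
  \<comment> \<open>These are \<open>(x powr (1/4) - 1)^2\<close> and its product with
    \<open>x powr (1/2)\<close>: midpoint convexity at exponents \<open>0\<close>,
    \<open>1/2\<close> and at \<open>1/2\<close>, \<open>1\<close>.\<close>
  have low: "0 \<le> x powr (1/2) + 1 - 2 * x powr (1/4)"
    and high: "0 \<le> x powr (1/2) + x - 2 * x powr (3/4)" if "0 < x" for x :: real
    using weighted_AM_GM_powr[OF that, of "1/2" "1/2" 0] weighted_AM_GM_powr[OF that, of "1/2" "1/2" 1] that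
    by (simp_all add: field_simps)
  have lowP: "0 \<le> (P \<sharp> Q) + P - 2 *\<^sub>R (P \<sharp>\<^bsub>1/4\<^esub> Q)"
    using comb[of "1/2" "1/4" "1/4" 1 0 1 "-2" 0] low by (simp add: algebra_simps)
  have highP: "0 \<le> (P \<sharp> Q) + Q - 2 *\<^sub>R (P \<sharp>\<^bsub>3/4\<^esub> Q)"
    using comb[of "1/2" "3/4" "3/4" 0 1 1 "-2" 0] high by (simp add: algebra_simps)
  have lowA: "0 \<le> \<Phi> (A \<sharp> B) + P - 2 *\<^sub>R \<Phi> (A \<sharp>\<^bsub>1/4\<^esub> B)"
    using image[of "1/2" "1/4" "1/4" 1 0 1 "-2" 0] low by (simp add: algebra_simps)
  have highA: "0 \<le> \<Phi> (A \<sharp> B) + Q - 2 *\<^sub>R \<Phi> (A \<sharp>\<^bsub>3/4\<^esub> B)"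
    using image[of "1/2" "3/4" "3/4" 0 1 1 "-2" 0] high by (simp add: algebra_simps)
  show ?thesis
  proof (rule conjI; rule impI; elim conjE)
    assume t: "0 < t" "t \<le> 1/2"
    then have R: "R = 1 - t" and r0: "r0 = min (2 * t) (1 - 2 * t)" and "0 \<le> r0"
      using assms(8-10) by auto
    have upper: "0 \<le> (1 - 2 * t - r0) *\<^sub>R P + 0 *\<^sub>R Q + (-1) *\<^sub>R (P \<sharp>\<^bsub>t\<^esub> Q)
        + (2 * t - r0) *\<^sub>R (P \<sharp>\<^bsub>1/2\<^esub> Q) + (2 * r0) *\<^sub>R (P \<sharp>\<^bsub>1/4\<^esub> Q)"
      by (rule comb) (use t refined_Young_le[OF _ t r0] in \<open>auto simp: algebra_simps\<close>)
    have lower: "0 \<le> 0 *\<^sub>R P + (1 - 2 * t - r0) *\<^sub>R Q + 1 *\<^sub>R \<Phi> (A \<sharp>\<^bsub>t\<^esub> B)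
        + (2 * t - 2 - r0) *\<^sub>R \<Phi> (A \<sharp>\<^bsub>1/2\<^esub> B) + (2 * r0) *\<^sub>R \<Phi> (A \<sharp>\<^bsub>3/4\<^esub> B)"
      by (rule image) (use t refined_Young_ge[OF _ t r0] in \<open>auto simp: algebra_simps\<close>)
    show "\<Phi> A \<sharp>\<^bsub>t\<^esub> \<Phi> B - \<Phi> (A \<sharp>\<^bsub>t\<^esub> B) \<le> ?E - ?I1 - ?I2 \<and> ?E - ?I1 - ?I2 \<le> ?E"
      unfolding R P_def[symmetric] Q_def[symmetric]
      by (intro conjI combine_mean_bounds mid lowP highA \<open>0 \<le> r0\<close>) (use upper lower t in simp_all)
  next
    assume t: "1/2 < t" "t < 1"
    \<comment> \<open>Written as \<open>1 - r\<close> with \<open>r = 1 - t\<close>, the shape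
      expected by \<open>combine_mean_bounds\<close>.\<close>
    then have R: "R = 1 - (1 - t)" and r0: "r0 = min (2 * (1 - t)) (1 - 2 * (1 - t))" and "0 \<le> r0"
      using assms(8-10) by auto
    note young = refined_Young_le'[OF _ less_imp_le[OF t(1)] t(2) r0]
      refined_Young_ge'[OF _ less_imp_le[OF t(1)] t(2) r0]
    have upper: "0 \<le> 0 *\<^sub>R P + (1 - 2 * (1 - t) - r0) *\<^sub>R Q + (-1) *\<^sub>R (P \<sharp>\<^bsub>t\<^esub> Q)
        + (2 * (1 - t) - r0) *\<^sub>R (P \<sharp>\<^bsub>1/2\<^esub> Q) + (2 * r0) *\<^sub>R (P \<sharp>\<^bsub>3/4\<^esub> Q)"
      by (rule comb) (use t young(1) in \<open>auto simp: algebra_simps\<close>)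
    have lower: "0 \<le> (1 - 2 * (1 - t) - r0) *\<^sub>R P + 0 *\<^sub>R Q + 1 *\<^sub>R \<Phi> (A \<sharp>\<^bsub>t\<^esub> B)
        + (2 * (1 - t) - 2 - r0) *\<^sub>R \<Phi> (A \<sharp>\<^bsub>1/2\<^esub> B) + (2 * r0) *\<^sub>R \<Phi> (A \<sharp>\<^bsub>1/4\<^esub> B)"
      by (rule image) (use t young(2) in \<open>auto simp: algebra_simps\<close>)
    \<comment> \<open>In this case the refinement of the images is subtracted first, opposite to the
      order in \<open>combine_mean_bounds\<close>.\<close>
    have comm: "X - Y - Z = X - Z - Y" for X Y Z :: "'h bounded_op"
      by (simp add: algebra_simps)
    have mid': "0 \<le> Q + P - 2 *\<^sub>R (P \<sharp> Q)" using mid by (simp only: add.commute)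
    show "\<Phi> A \<sharp>\<^bsub>t\<^esub> \<Phi> B - \<Phi> (A \<sharp>\<^bsub>t\<^esub> B) \<le> ?E - ?J1 - ?J2 \<and> ?E - ?J1 - ?J2 \<le> ?E"
      unfolding R P_def[symmetric] Q_def[symmetric]
        add.commute[of P Q] comm[of _ "r0 *\<^sub>R ((P \<sharp> Q) + Q - 2 *\<^sub>R (P \<sharp>\<^bsub>3/4\<^esub> Q))"]
      by (intro conjI combine_mean_bounds mid' highP lowA \<open>0 \<le> r0\<close>) (use upper lower t in simp_all)
  qed
qed

end
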